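(* Let $(\rho(\theta))_{\theta\in\mathbb{R}^L}$ be a second-order differentiable family of positive definite states on a finite-dimensional Hilbert space. For all $\alpha\in(0,1)\cup(1,\infty)$, the elements of the sandwiched Rényi information matrix are $$[\widetilde I_\alpha(\theta)]_{i,j}=\sum_{k,\ell}\widetilde\zeta_\alpha(\lambda_k,\lambda_\ell)\,\mathrm{Tr}\left[\Pi_k(\partial_i\rho(\theta))\Pi_\ell(\partial_j\rho(\theta))\right],$$ where $\partial_i=\frac{\partial}{\partial\theta_i}$, the spectral decomposition of $\rho(\theta)$ is $\rho(\theta)=\sum_k\lambda_k\Pi_k$, and for all $x,y>0$, $$\widetilde\zeta_\alpha(x,y):=\begin{cases}\frac{1}{1-\alpha}\left(\frac{x^{\frac{1-\alpha}\alpha}-y^{\frac{1-\alpha}\alpha}}{x^{\frac1\alpha}-y^{\frac1\alpha}}\right)&:x\neq y\\ \frac1x&:x=y.\end{cases}$$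
   Context: A state is a positive semi-definite operator of unit trace. For positive definite states $\rho,\sigma$ and $\alpha\in(0,1)\cup(1,\infty)$, the sandwiched Rényi relative entropy is $\widetilde D_\alpha(\rho\|\sigma):=\frac{1}{\alpha-1}\ln\mathrm{Tr}\big[(\sigma^{\frac{1-\alpha}{2\alpha}}\rho\,\sigma^{\frac{1-\alpha}{2\alpha}})^\alpha\big]$. The sandwiched Rényi information matrix has entries $[\widetilde I_\alpha(\theta)]_{i,j}:=\frac1\alpha\left.\frac{\partial^2}{\partial\varepsilon_i\partial\varepsilon_j}\widetilde D_\alpha(\rho(\theta)\|\rho(\theta+\varepsilon))\right|_{\varepsilon=0}$. *)

theory Defs
  imports "HOL-Analysis.Analysis"
begin

text \<open>
  Operators on a finite-dimensional Hilbert space are complex square matrices, acting on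
  \<open>complex ^ 'n\<close> with its standard inner product (antilinear in the first argument).
\<close>

definition cinner :: "complex ^ 'n \<Rightarrow> complex ^ 'n \<Rightarrow> complex" where
  "cinner v w = (\<Sum>i\<in>UNIV. cnj (v $ i) * w $ i)"

definition cadjoint :: "complex ^ 'n ^ 'n \<Rightarrow> complex ^ 'n ^ 'n" where
  "cadjoint A = (\<chi> i j. cnj (A $ j $ i))"

definition hermitian :: "complex ^ 'n ^ 'n \<Rightarrow> bool" where
  "hermitian A \<longleftrightarrow> cadjoint A = A"

definition positive_semidefinite :: "complex ^ 'n ^ 'n \<Rightarrow> bool" where
  "positive_semidefinite A \<longleftrightarrow> hermitian A \<and> (\<forall>v. 0 \<le> Re (cinner v (A *v v)))"

definition positive_definite :: "complex ^ 'n ^ 'n \<Rightarrow> bool" where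
  "positive_definite A \<longleftrightarrow> hermitian A \<and> (\<forall>v. v \<noteq> 0 \<longrightarrow> 0 < Re (cinner v (A *v v)))"

definition quantum_state :: "complex ^ 'n ^ 'n \<Rightarrow> bool" where
  "quantum_state A \<longleftrightarrow> positive_semidefinite A \<and> trace A = 1"

text \<open>
  The decomposition \<open>A = (\<Sum>k\<in>K. lam k *\<^sub>R P k)\<close> into pairwise distinct eigenvalues \<open>lam k\<close> and
  the corresponding (nonzero) orthogonal eigenprojections \<open>P k\<close>; it is unique up to relabelling
  of the index set.
\<close>

definition spectral_decomposition ::
    "complex ^ 'n ^ 'n \<Rightarrow> 'k set \<Rightarrow> ('k \<Rightarrow> real) \<Rightarrow> ('k \<Rightarrow> complex ^ 'n ^ 'n) \<Rightarrow> bool" where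
  "spectral_decomposition A K lam P \<longleftrightarrow>
     finite K \<and> inj_on lam K \<and>
     (\<forall>k\<in>K. hermitian (P k) \<and> P k ** P k = P k \<and> P k \<noteq> 0) \<and>
     (\<forall>k\<in>K. \<forall>l\<in>K. k \<noteq> l \<longrightarrow> P k ** P l = 0) \<and>
     (\<Sum>k\<in>K. P k) = mat 1 \<and>
     A = (\<Sum>k\<in>K. lam k *\<^sub>R P k)"

text \<open>
  Real powers by functional calculus. The value is meaningful for positive definite \<open>A\<close>; it does
  not depend on the decomposition chosen, see \<open>mat_powr_eq\<close> below.
\<close>

definition mat_powr :: "complex ^ 'n ^ 'n \<Rightarrow> real \<Rightarrow> complex ^ 'n ^ 'n" where
  "mat_powr A p =
     (THE B. \<exists>(K :: nat set) lam P.
        spectral_decomposition A K lam P \<and> B = (\<Sum>k\<in>K. (lam k powr p) *\<^sub>R P k))"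

text \<open>
  The trace below is real (and positive) for positive definite arguments, so taking its real part
  only changes the type.
\<close>

definition sandwiched_renyi :: "real \<Rightarrow> complex ^ 'n ^ 'n \<Rightarrow> complex ^ 'n ^ 'n \<Rightarrow> real" where
  "sandwiched_renyi \<alpha> \<rho> \<sigma> =
     (1 / (\<alpha> - 1)) *
     ln (Re (trace (mat_powr (mat_powr \<sigma> ((1 - \<alpha>) / (2 * \<alpha>)) ** \<rho> ** mat_powr \<sigma> ((1 - \<alpha>) / (2 * \<alpha>))) \<alpha>)))"

definition partial :: "'L \<Rightarrow> (real ^ 'L \<Rightarrow> 'b) \<Rightarrow> real ^ 'L \<Rightarrow> 'b :: real_normed_vector" where
  "partial i f x = vector_derivative (\<lambda>t. f (x + t *\<^sub>R axis i 1)) (at 0)"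

text \<open>Twice Frechet differentiable on the whole space; the second derivative need not be continuous.\<close>

definition twice_differentiable :: "('a :: real_normed_vector \<Rightarrow> 'b :: real_normed_vector) \<Rightarrow> bool" where
  "twice_differentiable f \<longleftrightarrow>
     (\<exists>f' :: 'a \<Rightarrow> 'a \<Rightarrow>\<^sub>L 'b.
        (\<forall>x. (f has_derivative blinfun_apply (f' x)) (at x)) \<and> (\<forall>x. f' differentiable (at x)))"

definition sandwiched_renyi_info ::
    "real \<Rightarrow> (real ^ 'L \<Rightarrow> complex ^ 'n ^ 'n) \<Rightarrow> real ^ 'L \<Rightarrow> real ^ 'L ^ 'L" where
  "sandwiched_renyi_info \<alpha> \<rho> \<theta> =
     (\<chi> i j. (1 / \<alpha>) *
        partial i (partial j (\<lambda>\<epsilon>. sandwiched_renyi \<alpha> (\<rho> \<theta>) (\<rho> (\<theta> + \<epsilon>)))) 0)"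

definition sandwiched_zeta :: "real \<Rightarrow> real \<Rightarrow> real \<Rightarrow> real" where
  "sandwiched_zeta \<alpha> x y =
     (if x \<noteq> y
      then (1 / (1 - \<alpha>)) *
           ((x powr ((1 - \<alpha>) / \<alpha>) - y powr ((1 - \<alpha>) / \<alpha>)) / (x powr (1 / \<alpha>) - y powr (1 / \<alpha>)))
      else 1 / x)"

lemma matrix_sum_left: "(\<Sum>k\<in>K. F k) ** (B :: complex ^ 'n ^ 'n) = (\<Sum>k\<in>K. F k ** B)"
  for F :: "_ \<Rightarrow> complex ^ 'n ^ 'n"
  by (auto simp: vec_eq_iff matrix_matrix_mult_def sum_distrib_right intro: sum.swap)

lemma matrix_sum_right: "(B :: complex ^ 'n ^ 'n) ** (\<Sum>k\<in>K. F k) = (\<Sum>k\<in>K. B ** F k)"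
  for F :: "_ \<Rightarrow> complex ^ 'n ^ 'n"
  by (induction K rule: infinite_finite_induct) (auto simp: matrix_add_ldistrib)

lemma matrix_scaleR_left: "(c *\<^sub>R A) ** B = c *\<^sub>R (A ** B)"
  for A B :: "complex ^ 'n ^ 'n"
  by (simp add: vec_eq_iff matrix_matrix_mult_def scaleR_sum_right)

lemma matrix_scaleR_right: "A ** (c *\<^sub>R B) = c *\<^sub>R (A ** B)"
  for A B :: "complex ^ 'n ^ 'n"
  by (simp add: vec_eq_iff matrix_matrix_mult_def scaleR_sum_right)

lemma spectral_decomposition_mult:
  assumes "spectral_decomposition A K lam P" "k \<in> K"
  shows "P k ** A = lam k *\<^sub>R P k" "A ** P k = lam k *\<^sub>R P k"
proof -
  have fin: "finite K" and A: "A = (\<Sum>l\<in>K. lam l *\<^sub>R P l)"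
    and PP: "\<And>l m. l \<in> K \<Longrightarrow> m \<in> K \<Longrightarrow> P l ** P m = (if l = m then P l else 0)"
    using assms(1) by (auto simp: spectral_decomposition_def)
  have "P k ** A = (\<Sum>l\<in>K. if k = l then lam k *\<^sub>R P k else 0)"
    unfolding A matrix_sum_right using assms(2)
    by (intro sum.cong) (auto simp: matrix_scaleR_right PP)
  then show "P k ** A = lam k *\<^sub>R P k" using fin assms(2) by simp
  have "A ** P k = (\<Sum>l\<in>K. if k = l then lam k *\<^sub>R P k else 0)"
    unfolding A matrix_sum_left using assms(2)
    by (intro sum.cong) (auto simp: matrix_scaleR_left PP)
  then show "A ** P k = lam k *\<^sub>R P k" using fin assms(2) by simp
qed

lemma spectral_calculus_unique:
  assumes "spectral_decomposition A K lam P" "spectral_decomposition A M mu Q"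
  shows "(\<Sum>k\<in>K. f (lam k) *\<^sub>R P k) = (\<Sum>m\<in>M. f (mu m) *\<^sub>R Q m)"
proof -
  have PQ: "f (lam k) *\<^sub>R (P k ** Q m) = f (mu m) *\<^sub>R (P k ** Q m)" if "k \<in> K" "m \<in> M" for k m
  proof -
    have "lam k *\<^sub>R (P k ** Q m) = (P k ** A) ** Q m"
      by (simp add: spectral_decomposition_mult[OF assms(1) that(1)] matrix_scaleR_left)
    also have "\<dots> = mu m *\<^sub>R (P k ** Q m)"
      by (simp add: spectral_decomposition_mult[OF assms(2) that(2)] matrix_scaleR_right
          flip: matrix_mul_assoc)
    finally show ?thesis by auto
  qed
  have idP: "(\<Sum>k\<in>K. P k) = mat 1" and idQ: "(\<Sum>m\<in>M. Q m) = mat 1"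
    using assms by (auto simp: spectral_decomposition_def)
  have "(\<Sum>k\<in>K. f (lam k) *\<^sub>R P k) = (\<Sum>k\<in>K. f (lam k) *\<^sub>R P k) ** (\<Sum>m\<in>M. Q m)"
    by (simp add: idQ)
  also have "\<dots> = (\<Sum>k\<in>K. \<Sum>m\<in>M. f (mu m) *\<^sub>R (P k ** Q m))"
    unfolding matrix_sum_left unfolding matrix_sum_right
    by (intro sum.cong refl) (simp add: matrix_scaleR_left PQ)
  also have "\<dots> = (\<Sum>k\<in>K. P k) ** (\<Sum>m\<in>M. f (mu m) *\<^sub>R Q m)"
    unfolding matrix_sum_left unfolding matrix_sum_right
    by (simp add: matrix_scaleR_right)
  finally show ?thesis by (simp add: idP)
qed

lemma mat_powr_eq:
  assumes "spectral_decomposition A K lam P"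
  shows "mat_powr A p = (\<Sum>k\<in>K. (lam k powr p) *\<^sub>R P k)"
proof -
  have "finite K" using assms by (simp add: spectral_decomposition_def)
  then obtain h where h: "bij_betw h {0..<card K} K"
    using ex_bij_betw_nat_finite by blast
  have inj: "inj_on h {0..<card K}" and im: "h ` {0..<card K} = K"
    using h by (auto simp: bij_betw_def)
  have mem: "h k \<in> K" if "k < card K" for k
    using that im by force
  have ne: "h k \<noteq> h l" if "k < card K" "l < card K" "k \<noteq> l" for k l
    using that inj by (auto dest: inj_onD)
  have ex: "spectral_decomposition A {0..<card K} (lam \<circ> h) (P \<circ> h)"
    using assms mem ne comp_inj_on[OF inj, of lam] im
      sum.reindex_bij_betw[OF h, of P]
      sum.reindex_bij_betw[OF h, of "\<lambda>k. lam k *\<^sub>R P k"]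
    unfolding spectral_decomposition_def comp_apply
    by simp
  show ?thesis
    unfolding mat_powr_def
  proof (rule the_equality)
    show "\<exists>(M :: nat set) mu Q. spectral_decomposition A M mu Q \<and>
        (\<Sum>k\<in>K. (lam k powr p) *\<^sub>R P k) = (\<Sum>m\<in>M. (mu m powr p) *\<^sub>R Q m)"
      by (intro exI conjI)
        (rule ex, rule spectral_calculus_unique[OF assms ex, where f = "\<lambda>x. x powr p"])
  next
    fix B
    assume "\<exists>(M :: nat set) mu Q. spectral_decomposition A M mu Q \<and>
        B = (\<Sum>m\<in>M. (mu m powr p) *\<^sub>R Q m)"
    then obtain M :: "nat set" and mu Q where
      sd: "spectral_decomposition A M mu Q" and B: "B = (\<Sum>m\<in>M. (mu m powr p) *\<^sub>R Q m)"
      by (elim exE conjE)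
    show "B = (\<Sum>k\<in>K. (lam k powr p) *\<^sub>R P k)"
      unfolding B by (rule spectral_calculus_unique[OF sd assms, where f = "\<lambda>x. x powr p"])
  qed
qed

end

theory Submission
  imports Defs "HOL-Computational_Algebra.Fundamental_Theorem_Algebra"
begin

text \<open>
  Put \<open>s = (1 - \<alpha>) / (2 * \<alpha>)\<close>, \<open>R = \<rho> \<theta>\<close>, and for a state \<open>A\<close> near \<open>R\<close> let \<open>S = A powr s\<close>,
  \<open>L = S R S\<close>. The Daleckii--Krein formula, which expresses the derivative of a matrix function by
  divided differences in an eigenbasis, gives \<open>d (Tr (L powr \<alpha>)) = \<alpha> Tr (Z dS)\<close> with
  \<open>Z = R S (L powr (\<alpha> - 1)) + (L powr (\<alpha> - 1)) S R\<close>. As \<open>Tr ((A powr (1 - s)) dS) = s Tr (dA) = 0\<close>,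
  one may subtract \<open>2 (A powr (1 - s))\<close> from \<open>Z\<close>, after which \<open>Z\<close> vanishes at \<open>A = R\<close>. The second
  derivative at \<open>R\<close> is then \<open>\<alpha> Tr (dZ dS)\<close>, which only involves first derivatives of matrix
  powers; \<open>dS\<close> merely has to be continuous. The product of the two divided-difference symbols is a
  multiple of \<open>sandwiched_zeta\<close>.
\<close>

section \<open>Hermitian matrices and the spectral theorem\<close>

text \<open>Eigenvalues may split or merge along the family, so spectral projections need not be
  continuous in the parameter and a spectral decomposition cannot be differentiated term by term.
  All derivatives are therefore stated for expressions depending on the matrix alone: double sums
  over projections with a continuous symbol, which stay continuous even where the projections jump.

  A product whose first factor vanishes at the base point is differentiated there using the
  derivative of that factor and mere continuity of the other; hence the correction of
  \<open>Z\<close>. Its coefficient 2 is forced: at \<open>A = R\<close> everything is a power of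
  \<open>R\<close>, and both summands of \<open>Z\<close> equal R^(1 + s - 2s) = R^(1 - s). The
  logarithm leaves no trace in the second derivative either, because the gradient vanishes at
  \<open>R\<close> and the trace functional equals Tr R = 1 there.

  With u = x^s and v = y^s the comparison of symbols becomes a rational identity in x, y, u,
  v.\<close>

lemma matrix_add_rdistrib: "(A + B) ** C = A ** C + B ** C" for A B C :: "complex ^ 'n ^ 'n"
  by (simp add: vec_eq_iff matrix_matrix_mult_def distrib_right sum.distrib)

lemma bounded_bilinear_matrix_mult:
  "bounded_bilinear ((**) :: complex ^ 'n ^ 'n \<Rightarrow> complex ^ 'n ^ 'n \<Rightarrow> complex ^ 'n ^ 'n)"
  unfolding bilinear_conv_bounded_bilinear[symmetric] bilinear_def
  by (auto intro!: linearI simp: matrix_add_ldistrib matrix_add_rdistrib matrix_scaleR_left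
      matrix_scaleR_right)

interpretation mmult: bounded_bilinear
  "(**) :: complex ^ 'n ^ 'n \<Rightarrow> complex ^ 'n ^ 'n \<Rightarrow> complex ^ 'n ^ 'n"
  by (rule bounded_bilinear_matrix_mult)

lemma bounded_linear_trace: "bounded_linear (trace :: complex ^ 'n ^ 'n \<Rightarrow> complex)"
  by (intro linear_conv_bounded_linear[THEN iffD1] linearI)
    (simp_all add: trace_def sum.distrib scaleR_sum_right)

lemma bounded_linear_cadjoint: "bounded_linear (cadjoint :: complex ^ 'n ^ 'n \<Rightarrow> _)"
  by (intro linear_conv_bounded_linear[THEN iffD1] linearI)
    (simp_all add: cadjoint_def vec_eq_iff)

lemmas trace_linear = bounded_linear.linear[OF bounded_linear_trace]
lemmas trace_zero = linear_0[OF trace_linear]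
lemmas trace_scaleR = linear_scale[OF trace_linear]
lemmas trace_sum_matrix = linear_sum[OF trace_linear]

lemmas cadjoint_linear = bounded_linear.linear[OF bounded_linear_cadjoint]
lemmas cadjoint_diff = linear_diff[OF cadjoint_linear]
lemmas cadjoint_scaleR = linear_scale[OF cadjoint_linear]
lemmas cadjoint_sum = linear_sum[OF cadjoint_linear]

lemma trace_mult_commute: "trace (A ** B) = trace (B ** A)" for A B :: "complex ^ 'n ^ 'n"
  unfolding trace_def matrix_matrix_mult_def
  by (simp add: mult.commute) (rule sum.swap)

lemma cadjoint_mult: "cadjoint (A ** B) = cadjoint B ** cadjoint A"
  by (simp add: cadjoint_def vec_eq_iff matrix_matrix_mult_def mult.commute)

lemma cadjoint_cadjoint: "cadjoint (cadjoint A) = A"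
  by (simp add: cadjoint_def vec_eq_iff)

lemma cadjoint_mat: "cadjoint (mat a) = mat (cnj a)"
  by (auto simp: cadjoint_def vec_eq_iff mat_def)

lemma trace_cadjoint: "trace (cadjoint A) = cnj (trace A)"
  by (simp add: cadjoint_def trace_def)

lemma mat_mult_component: "(mat a ** B) $ i $ j = a * B $ i $ j" for B :: "complex ^ 'n ^ 'n"
  by (simp add: mat_def matrix_matrix_mult_def if_distrib[where f = "\<lambda>x. x * _"] cong: if_cong)

lemma mult_mat_component: "(B ** mat a) $ i $ j = B $ i $ j * a" for B :: "complex ^ 'n ^ 'n"
  by (simp add: mat_def matrix_matrix_mult_def if_distrib[where f = "\<lambda>x. _ * x"] cong: if_cong)

lemma mat_mult_commute: "mat a ** B = B ** mat a" for B :: "complex ^ 'n ^ 'n"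
  by (simp add: vec_eq_iff mat_mult_component mult_mat_component)

lemma mat_of_real_mult: "mat (complex_of_real a) ** B = a *\<^sub>R B" for B :: "complex ^ 'n ^ 'n"
  by (simp add: vec_eq_iff mat_mult_component) (simp add: scaleR_conv_of_real)

text \<open>The norm of the nested vector type is the Frobenius norm. This is the source of
  definiteness: a matrix vanishes as soon as its Gram matrix does, and the norm of a projection is
  read off from its trace.\<close>

lemma norm_matrix_eq_trace: "(norm X)\<^sup>2 = Re (trace (cadjoint X ** X))"
  for X :: "complex ^ 'n ^ 'n"
proof -
  have "(norm X)\<^sup>2 = (\<Sum>i\<in>UNIV. \<Sum>j\<in>UNIV. (cmod (X $ i $ j))\<^sup>2)"
    by (simp add: norm_vec_def L2_set_def real_sqrt_pow2 sum_nonneg)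
  also have "\<dots> = (\<Sum>j\<in>UNIV. \<Sum>i\<in>UNIV. (cmod (X $ i $ j))\<^sup>2)"
    by (rule sum.swap)
  also have "\<dots> = Re (trace (cadjoint X ** X))"
    by (simp add: trace_def matrix_matrix_mult_def cadjoint_def cmod_power2)
      (simp add: power2_eq_square)
  finally show ?thesis .
qed

lemma cadjoint_self_mult_eq_0D: "cadjoint X ** X = 0 \<Longrightarrow> X = 0" for X :: "complex ^ 'n ^ 'n"
  using norm_matrix_eq_trace[of X] by (simp add: trace_zero)

text \<open>This is p(A) Y in Horner form. Keeping \<open>Y\<close> as an argument lets roots of p
  be stripped off by changing \<open>Y\<close>. The factor \<open>mat a\<close> is multiplication by
  the complex scalar \<open>a\<close>.\<close>

definition poly_act :: "complex ^ 'n ^ 'n \<Rightarrow> complex poly \<Rightarrow> complex ^ 'n ^ 'n \<Rightarrow> complex ^ 'n ^ 'n"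
  where "poly_act A p Y = fold_coeffs (\<lambda>a Z. mat a ** Y + A ** Z) p 0"

lemma poly_act_0: "poly_act A 0 Y = 0"
  by (simp add: poly_act_def)

lemma mat_0_mult: "mat 0 ** Y = 0" for Y :: "complex ^ 'n ^ 'n"
  by (simp add: vec_eq_iff mat_mult_component)

lemma poly_act_pCons: "poly_act A (pCons a p) Y = mat a ** Y + A ** poly_act A p Y"
  by (cases "a = 0 \<and> p = 0") (auto simp: poly_act_def mat_0_mult)

lemma mat_add: "mat (a + b) = mat a + (mat b :: complex ^ 'n ^ 'n)"
  and mat_mult: "mat (a * b) = mat a ** (mat b :: complex ^ 'n ^ 'n)"
  by (auto simp: vec_eq_iff mat_mult_component) (auto simp: mat_def)

lemma poly_act_add: "poly_act A (p + q) Y = poly_act A p Y + poly_act A q Y"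
  by (induction p q rule: poly_induct2)
    (simp_all add: poly_act_0 poly_act_pCons mat_add mmult.add_left mmult.add_right)

lemma poly_act_smult: "poly_act A (smult c p) Y = mat c ** poly_act A p Y"
proof (induction p)
  case (pCons a p)
  have "A ** (mat c ** poly_act A p Y) = mat c ** (A ** poly_act A p Y)"
    by (metis mat_mult_commute matrix_mul_assoc)
  then show ?case
    using pCons by (simp add: poly_act_pCons mat_mult mmult.add_right matrix_mul_assoc)
qed (simp add: poly_act_0)

lemma poly_act_shift:
  "poly_act A p (A ** Y - mat c ** Y) = A ** poly_act A p Y - mat c ** poly_act A p Y"
proof (induction p)
  case (pCons a p)
  have [simp]: "A ** (mat d ** Z) = mat d ** (A ** Z)" for d Z
    by (metis mat_mult_commute matrix_mul_assoc)
  have "mat a ** (mat c ** Y) = mat c ** (mat a ** Y)"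
    by (metis mat_mult_commute matrix_mul_assoc)
  then show ?case
    using pCons by (simp add: poly_act_pCons mmult.add_right mmult.diff_right)
qed (simp add: poly_act_0)

text \<open>The factor A - c commutes with p(A), so it can be moved onto the argument. This lowers
  the degree at the cost of replacing \<open>Y\<close> by (A - c) Y, which is the induction step of
  the eigenvector splitting.\<close>

lemma poly_act_linear_factor:
  "poly_act A ([:- c, 1:] * p) Y = poly_act A p (A ** Y - mat c ** Y)"
proof -
  have "mat (- c) ** poly_act A p Y = - (mat c ** poly_act A p Y)"
    by (simp add: vec_eq_iff mat_mult_component)
  moreover have "[:- c, 1:] * p = smult (- c) p + pCons 0 p" by simp
  ultimately show ?thesis
    by (simp only: poly_act_shift poly_act_add poly_act_smult poly_act_pCons mat_0_mult) simp
qed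

text \<open>The Gram matrix of A Y is Y* A A Y. In this way Hermiticity excludes generalized
  eigenvectors that are not eigenvectors.\<close>

lemma hermitian_square_mult_eq_0D:
  fixes A Y :: "complex ^ 'n ^ 'n"
  assumes "hermitian A" "A ** (A ** Y) = 0"
  shows "A ** Y = 0"
proof (rule cadjoint_self_mult_eq_0D)
  show "cadjoint (A ** Y) ** (A ** Y) = 0"
    using assms by (simp add: cadjoint_mult hermitian_def flip: matrix_mul_assoc)
qed

text \<open>Evaluating Y* A Y on either side gives both a and its conjugate times the Gram matrix of
  \<open>Y\<close>.\<close>

lemma hermitian_nonreal_eigen:
  fixes A Y :: "complex ^ 'n ^ 'n"
  assumes A: "hermitian A" and Y: "A ** Y = mat a ** Y" and a: "a \<notin> \<real>"
  shows "Y = 0"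
proof (rule cadjoint_self_mult_eq_0D)
  let ?W = "cadjoint Y ** Y"
  have "cadjoint (A ** Y) ** Y = cadjoint Y ** (A ** Y)"
    using A by (simp add: cadjoint_mult hermitian_def matrix_mul_assoc)
  then have "mat (cnj a) ** ?W = mat a ** ?W"
    unfolding Y by (metis cadjoint_mat cadjoint_mult mat_mult_commute matrix_mul_assoc)
  then have "cnj a * ?W $ i $ j = a * ?W $ i $ j" for i j
    by (metis mat_mult_component)
  moreover have "cnj a \<noteq> a"
    using a by (simp add: Reals_cnj_iff)
  ultimately show "?W = 0"
    by (simp add: vec_eq_iff)
qed

text \<open>
  Peeling off the roots of an annihilating polynomial one at a time splits every column of \<open>Y\<close>
  into eigenvectors; no multiplicities or nonreal roots survive because \<open>A\<close> is Hermitian.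
\<close>

lemma hermitian_eigen_splitting:
  fixes A Y :: "complex ^ 'n ^ 'n"
  assumes A: "hermitian A" and "p \<noteq> 0" "poly_act A p Y = 0"
  shows "\<exists>(E :: real set) Z. finite E \<and> Y = (\<Sum>x\<in>E. Z x) \<and> (\<forall>x\<in>E. A ** Z x = x *\<^sub>R Z x)"
  using assms(2,3)
proof (induction "degree p" arbitrary: p Y)
  case 0
  then obtain c where c: "p = [:c:]" "c \<noteq> 0"
    by (metis degree_eq_zeroE pCons_eq_0_iff)
  then have "Y = 0"
    using 0 by (simp add: poly_act_pCons poly_act_0 vec_eq_iff mat_mult_component)
  then show ?case
    by (intro exI[of _ "{}"]) simp
next
  case (Suc n)
  then obtain a where "poly p a = 0"
    using fundamental_theorem_of_algebra[of p] by (auto simp: constant_degree)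
  then obtain q where q: "p = [:- a, 1:] * q"
    by (auto simp: poly_eq_0_iff_dvd)
  then have "q \<noteq> 0" "degree q = n"
    using Suc.hyps(2) Suc.prems(1) degree_mult_eq[of "[:- a, 1:]" q] by (auto simp del: mult_pCons_left)
  moreover have "poly_act A q (A ** Y - mat a ** Y) = 0"
    using Suc.prems(2) unfolding q poly_act_linear_factor .
  ultimately obtain E :: "real set" and Z where E: "finite E"
    and Z: "A ** Y - mat a ** Y = (\<Sum>x\<in>E. Z x)" and eig: "\<And>x. x \<in> E \<Longrightarrow> A ** Z x = x *\<^sub>R Z x"
    using Suc.hyps(1)[of q] by metis
  define F where "F = {x\<in>E. of_real x \<noteq> a}"
  \<comment> \<open>On \<open>Z x\<close> the matrix \<open>A\<close> acts as x, so dividing by x -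
    a solves (A - a) V = Z. Subtracting these solutions from \<open>Y\<close> leaves a remainder
    \<open>U\<close> for which (A - a) U is at most the single component with eigenvalue a.\<close>
  define V where "V x = mat (1 / (of_real x - a)) ** Z x" for x
  have V_eig: "A ** V x = x *\<^sub>R V x" if "x \<in> F" for x
    using eig[of x] that unfolding V_def F_def
    by (metis (mono_tags, lifting) mat_mult_commute matrix_mul_assoc matrix_scaleR_right mem_Collect_eq)
  have V_shift: "A ** V x - mat a ** V x = Z x" if "x \<in> F" for x
  proof -
    have "A ** V x - mat a ** V x = mat (of_real x) ** V x - mat a ** V x"
      using V_eig[OF that] by (simp add: mat_of_real_mult)
    also have "\<dots> = Z x"
      using that by (simp add: vec_eq_iff mat_mult_component V_def F_def divide_simps)
        (simp add: algebra_simps)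
    finally show ?thesis .
  qed
  define U where "U = Y - (\<Sum>x\<in>F. V x)"
  have "A ** U - mat a ** U = (A ** Y - mat a ** Y) - (\<Sum>x\<in>F. A ** V x - mat a ** V x)"
    unfolding U_def mmult.diff_right mmult.sum_right sum_subtractf by simp
  also have "\<dots> = (\<Sum>x\<in>E - F. Z x)"
    using E by (simp add: Z V_shift sum_diff F_def)
  finally have U: "A ** U - mat a ** U = (\<Sum>x\<in>E - F. Z x)" .
  \<comment> \<open>For nonreal a no exceptional component exists, since the set \<open>E\<close> is
    real. For real a that component is annihilated by A - a, so (A - a)^2 kills \<open>U\<close>,
    and then already A - a does.\<close>
  have U0: "A ** U = mat a ** U"
  proof (cases "a \<in> \<real>")
    case False
    then have "E - F = {}" by (auto simp: F_def)
    then show ?thesis using U by (simp only: sum.empty right_minus_eq)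
  next
    case True
    then obtain r where r: "a = of_real r" by (auto elim: Reals_cases)
    define B where "B = A - r *\<^sub>R mat 1"
    have B: "B ** X = A ** X - mat a ** X" for X :: "complex ^ 'n ^ 'n"
      by (simp add: B_def mmult.diff_left matrix_scaleR_left r mat_of_real_mult)
    have hB: "hermitian B"
      using A by (simp add: hermitian_def B_def cadjoint_diff cadjoint_scaleR cadjoint_mat)
    have "E - F \<subseteq> {r}" by (auto simp: F_def r)
    then have "B ** (B ** U) = 0"
      unfolding B[of U] U
      by (auto simp: mmult.sum_right B eig r mat_of_real_mult intro!: sum.neutral)
    then have "B ** U = 0"
      by (rule hermitian_square_mult_eq_0D[OF hB])
    then show ?thesis
      by (simp add: B)
  qed
  show ?case
  proof (cases "a \<in> \<real>")
    case False
    then have "U = 0" using hermitian_nonreal_eigen[OF A U0] by simp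
    then have "Y = (\<Sum>x\<in>F. V x)" by (simp add: U_def)
    then show ?thesis
      using E V_eig by (intro exI[of _ F] exI[of _ V]) (auto simp: F_def)
  next
    case True
    then obtain r where r: "a = of_real r" by (auto elim: Reals_cases)
    have rF: "r \<notin> F" by (simp add: F_def r)
    have fF: "finite F" using E by (simp add: F_def)
    have "Y = U + (\<Sum>x\<in>F. V x)" by (simp add: U_def)
    also have "(\<Sum>x\<in>F. V x) = (\<Sum>x\<in>F. (V(r := U)) x)"
      using rF by (intro sum.cong) auto
    finally have "Y = (\<Sum>x\<in>insert r F. (V(r := U)) x)"
      using rF fF by simp
    moreover have "A ** U = r *\<^sub>R U"
      using U0 by (simp add: r mat_of_real_mult)
    ultimately show ?thesis
      using fF V_eig by (intro exI[of _ "insert r F"] exI[of _ "V(r := U)"]) auto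
  qed
qed

lemma poly_act_sum: "poly_act A (\<Sum>i\<in>I. p i) Y = (\<Sum>i\<in>I. poly_act A (p i) Y)"
  by (induction I rule: infinite_finite_induct) (simp_all add: poly_act_0 poly_act_add)

lemma poly_act_monom: "poly_act A (monom c n) Y = mat c ** (((**) A) ^^ n) Y"
proof (induction n)
  case 0
  show ?case by (simp add: monom_0 poly_act_pCons poly_act_0)
next
  case (Suc n)
  have "A ** (mat c ** Z) = mat c ** (A ** Z)" for Z
    by (metis mat_mult_commute matrix_mul_assoc)
  with Suc show ?case by (simp add: monom_Suc poly_act_pCons mat_0_mult)
qed

text \<open>The vectors A^i Y live in a space of finite real dimension, so they are linearly
  dependent, and a real dependence suffices. Dependence is a property of sets, hence the separate
  case of two coinciding powers, where a difference of monomials serves.\<close>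

lemma annihilating_poly_exists:
  fixes A Y :: "complex ^ 'n ^ 'n"
  shows "\<exists>p. p \<noteq> 0 \<and> poly_act A p Y = 0"
proof -
  let ?w = "\<lambda>i. (((**) A) ^^ i) Y"
  show ?thesis
  proof (cases "inj ?w")
    case False
    then obtain i j where ij: "i \<noteq> j" "?w i = ?w j" by (auto simp: inj_def)
    have "poly_act A (monom 1 i + monom (-1) j) Y = 0"
      using ij(2) by (simp add: poly_act_add poly_act_monom) (simp add: vec_eq_iff mat_mult_component)
    moreover have "coeff (monom 1 i + monom (-1 :: complex) j) i = 1"
      using ij(1) by simp
    then have "monom 1 i + monom (-1 :: complex) j \<noteq> 0"
      by (metis coeff_0 zero_neq_one)
    ultimately show ?thesis by blast
  next
    case True
    \<comment> \<open>One index more than the real dimension of the matrix space, as the index 0 is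
      included.\<close>
    let ?N = "{..DIM(complex ^ 'n ^ 'n)}"
    have inj: "inj_on ?w ?N" using True by (simp add: inj_on_def inj_def)
    then have "card (?w ` ?N) > DIM(complex ^ 'n ^ 'n)"
      by (simp add: card_image)
    then have "dependent (?w ` ?N)"
      by (intro dependent_biggerset) auto
    then obtain u v where v: "v \<in> ?w ` ?N" "u v \<noteq> 0" and u: "(\<Sum>v\<in>?w ` ?N. u v *\<^sub>R v) = 0"
      using dependent_finite[of "?w ` ?N"] by auto
    from v obtain k where k: "k \<in> ?N" "u (?w k) \<noteq> 0" by auto
    define p where "p = (\<Sum>i\<in>?N. monom (complex_of_real (u (?w i))) i)"
    have "poly_act A p Y = (\<Sum>i\<in>?N. u (?w i) *\<^sub>R ?w i)"
      by (simp add: p_def poly_act_sum poly_act_monom mat_of_real_mult)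
    also have "\<dots> = 0"
      using u sum.reindex[OF inj, of "\<lambda>v. u v *\<^sub>R v"] by (simp add: comp_def)
    finally have "poly_act A p Y = 0" .
    moreover have "coeff p k = of_real (u (?w k))"
      using k(1) by (simp add: p_def coeff_sum)
    then have "p \<noteq> 0" using k(2) by auto
    ultimately show ?thesis by blast
  qed
qed

text \<open>Splitting the identity matrix into eigencomponents already yields the eigenprojections:
  components of distinct eigenvalues are orthogonal by Hermiticity, and summing to the identity
  makes each of them idempotent and self-adjoint.\<close>

theorem hermitian_spectral_decomposition:
  fixes A :: "complex ^ 'n ^ 'n"
  assumes A: "hermitian A"
  shows "\<exists>(K :: real set) P. spectral_decomposition A K (\<lambda>x. x) P"
proof -
  obtain E :: "real set" and Z where E: "finite E" and Z: "mat 1 = (\<Sum>x\<in>E. Z x)"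
    and eig: "\<And>x. x \<in> E \<Longrightarrow> A ** Z x = x *\<^sub>R Z x"
    using hermitian_eigen_splitting[OF A] annihilating_poly_exists[of A "mat 1"] by metis
  have orth: "cadjoint (Z x) ** Z y = 0" if "x \<in> E" "y \<in> E" "x \<noteq> y" for x y
  proof -
    have "x *\<^sub>R (cadjoint (Z x) ** Z y) = cadjoint (A ** Z x) ** Z y"
      by (simp add: eig that cadjoint_scaleR matrix_scaleR_left)
    also have "\<dots> = cadjoint (Z x) ** (A ** Z y)"
      using A by (simp add: cadjoint_mult hermitian_def matrix_mul_assoc)
    also have "\<dots> = y *\<^sub>R (cadjoint (Z x) ** Z y)"
      by (simp add: eig that matrix_scaleR_right)
    finally show ?thesis using that(3) by simp
  qed
  \<comment> \<open>Insert the identity as the sum of all \<open>Z y\<close>; orthogonality removes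
    every term but one. The right-hand side is self-adjoint, hence so is \<open>Z x\<close>.\<close>
  have sq: "cadjoint (Z x) = cadjoint (Z x) ** Z x" if "x \<in> E" for x
  proof -
    have "cadjoint (Z x) = cadjoint (Z x) ** (\<Sum>y\<in>E. Z y)"
      by (simp flip: Z)
    also have "\<dots> = (\<Sum>y\<in>E. if y = x then cadjoint (Z x) ** Z x else 0)"
      unfolding mmult.sum_right using that by (intro sum.cong) (auto simp: orth)
    finally show ?thesis using E that by simp
  qed
  have herm: "cadjoint (Z x) = Z x" if "x \<in> E" for x
    using sq[OF that] by (metis cadjoint_cadjoint cadjoint_mult)
  define K where "K = {x\<in>E. Z x \<noteq> 0}"
  have 1: "(\<Sum>x\<in>K. Z x) = mat 1"
    unfolding Z K_def using E by (intro sum.mono_neutral_left) auto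
  have "A = A ** (\<Sum>x\<in>K. Z x)" by (simp add: 1)
  also have "\<dots> = (\<Sum>x\<in>K. x *\<^sub>R Z x)"
    unfolding mmult.sum_right by (intro sum.cong) (auto simp: K_def eig)
  finally have A_eq: "A = (\<Sum>x\<in>K. x *\<^sub>R Z x)" .
  have "spectral_decomposition A K (\<lambda>x. x) Z"
    unfolding spectral_decomposition_def
    using E 1 A_eq[symmetric] sq orth herm by (auto simp: K_def hermitian_def)
  then show ?thesis by blast
qed

section \<open>Functions of a Hermitian matrix\<close>

lemma
  assumes "spectral_decomposition A K lam P"
  shows spectral_decomposition_finite: "finite K"
    and spectral_decomposition_sum: "(\<Sum>k\<in>K. P k) = mat 1"
    and spectral_decomposition_nonzero: "k \<in> K \<Longrightarrow> P k \<noteq> 0"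
    and spectral_decomposition_cadjoint: "k \<in> K \<Longrightarrow> cadjoint (P k) = P k"
    and spectral_decomposition_orthogonal:
      "k \<in> K \<Longrightarrow> l \<in> K \<Longrightarrow> P k ** P l = (if k = l then P k else 0)"
  using assms by (auto simp: spectral_decomposition_def hermitian_def)

lemma spectral_decomposition_hermitian:
  assumes "spectral_decomposition A K lam P"
  shows "hermitian A"
proof -
  have "cadjoint A = (\<Sum>k\<in>K. lam k *\<^sub>R cadjoint (P k))"
    using assms by (simp add: spectral_decomposition_def cadjoint_sum cadjoint_scaleR)
  also have "\<dots> = A"
    using assms by (simp add: spectral_decomposition_def hermitian_def)
  finally show ?thesis by (simp add: hermitian_def)
qed

text \<open>With one eigenvalue held fixed, the double sum is an ordinary functional calculus in the
  other, so uniqueness of the latter is applied once on the left and once on the right.\<close>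

lemma spectral_schur_unique:
  assumes "spectral_decomposition A K lam P" "spectral_decomposition A M mu Q"
  shows "(\<Sum>k\<in>K. \<Sum>l\<in>K. psi (lam k) (lam l) *\<^sub>R (P k ** H ** P l)) =
    (\<Sum>k\<in>M. \<Sum>l\<in>M. psi (mu k) (mu l) *\<^sub>R (Q k ** H ** Q l))"
proof -
  have "(\<Sum>k\<in>K. \<Sum>l\<in>K. psi (lam k) (lam l) *\<^sub>R (P k ** H ** P l)) =
      (\<Sum>l\<in>K. (\<Sum>k\<in>K. psi (lam k) (lam l) *\<^sub>R P k) ** H ** P l)"
    by (subst sum.swap) (simp add: mmult.sum_left matrix_scaleR_left)
  also have "\<dots> = (\<Sum>l\<in>K. (\<Sum>m\<in>M. psi (mu m) (lam l) *\<^sub>R Q m) ** H ** P l)"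
    by (intro sum.cong refl arg_cong2[where f = "(**)"]) (rule spectral_calculus_unique[OF assms])
  also have "\<dots> = (\<Sum>m\<in>M. Q m ** H ** (\<Sum>l\<in>K. psi (mu m) (lam l) *\<^sub>R P l))"
    unfolding mmult.sum_left mmult.sum_right matrix_scaleR_left matrix_scaleR_right
    by (rule sum.swap)
  also have "\<dots> = (\<Sum>m\<in>M. Q m ** H ** (\<Sum>l\<in>M. psi (mu m) (mu l) *\<^sub>R Q l))"
    by (intro sum.cong refl arg_cong2[where f = "(**)"]) (rule spectral_calculus_unique[OF assms])
  also have "\<dots> = (\<Sum>k\<in>M. \<Sum>l\<in>M. psi (mu k) (mu l) *\<^sub>R (Q k ** H ** Q l))"
    by (simp add: mmult.sum_right matrix_scaleR_right)
  finally show ?thesis .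
qed

text \<open>
  The double operator integral with symbol \<open>psi\<close>: the entries of \<open>H\<close> in an eigenbasis of \<open>A\<close>
  are multiplied by \<open>psi\<close> of the two eigenvalues.
\<close>

definition mat_schur ::
    "(real \<Rightarrow> real \<Rightarrow> real) \<Rightarrow> complex ^ 'n ^ 'n \<Rightarrow> complex ^ 'n ^ 'n \<Rightarrow> complex ^ 'n ^ 'n" where
  "mat_schur psi A H =
     (THE C. \<exists>(K :: real set) P. spectral_decomposition A K (\<lambda>x. x) P \<and>
        C = (\<Sum>k\<in>K. \<Sum>l\<in>K. psi k l *\<^sub>R (P k ** H ** P l)))"

text \<open>Encoded as a double sum whose symbol ignores its second variable, so that the continuity
  theorem for \<open>mat_schur\<close> covers functions of a matrix as well.\<close>

definition mat_fun :: "(real \<Rightarrow> real) \<Rightarrow> complex ^ 'n ^ 'n \<Rightarrow> complex ^ 'n ^ 'n" where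
  "mat_fun f A = mat_schur (\<lambda>x y. f x) A (mat 1)"

lemma mat_schur_eq:
  assumes sd: "spectral_decomposition A K lam P"
  shows "mat_schur psi A H = (\<Sum>k\<in>K. \<Sum>l\<in>K. psi (lam k) (lam l) *\<^sub>R (P k ** H ** P l))"
proof -
  obtain M :: "real set" and Q where "spectral_decomposition A M (\<lambda>x. x) Q"
    using hermitian_spectral_decomposition[OF spectral_decomposition_hermitian[OF sd]] by blast
  note Q = this
  show ?thesis
    unfolding mat_schur_def
  proof (rule the_equality)
    show "\<exists>(M :: real set) Q. spectral_decomposition A M (\<lambda>x. x) Q \<and>
        (\<Sum>k\<in>K. \<Sum>l\<in>K. psi (lam k) (lam l) *\<^sub>R (P k ** H ** P l)) =
        (\<Sum>k\<in>M. \<Sum>l\<in>M. psi k l *\<^sub>R (Q k ** H ** Q l))"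
      by (intro exI conjI) (rule Q, rule spectral_schur_unique[OF sd Q])
  next
    fix C
    assume "\<exists>(M :: real set) Q. spectral_decomposition A M (\<lambda>x. x) Q \<and>
        C = (\<Sum>k\<in>M. \<Sum>l\<in>M. psi k l *\<^sub>R (Q k ** H ** Q l))"
    then obtain M :: "real set" and Q where Q: "spectral_decomposition A M (\<lambda>x. x) Q"
      and C: "C = (\<Sum>k\<in>M. \<Sum>l\<in>M. psi k l *\<^sub>R (Q k ** H ** Q l))"
      by (elim exE conjE)
    show "C = (\<Sum>k\<in>K. \<Sum>l\<in>K. psi (lam k) (lam l) *\<^sub>R (P k ** H ** P l))"
      unfolding C by (rule spectral_schur_unique[OF Q sd])
  qed
qed

lemma mat_fun_eq:
  assumes sd: "spectral_decomposition A K lam P"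
  shows "mat_fun f A = (\<Sum>k\<in>K. f (lam k) *\<^sub>R P k)"
proof -
  have "mat_fun f A = (\<Sum>k\<in>K. \<Sum>l\<in>K. f (lam k) *\<^sub>R (P k ** P l))"
    by (simp add: mat_fun_def mat_schur_eq[OF sd])
  also have "\<dots> = (\<Sum>k\<in>K. f (lam k) *\<^sub>R P k)"
    using spectral_decomposition_sum[OF sd]
    by (simp flip: scaleR_sum_right mmult.sum_right)
  finally show ?thesis .
qed

lemma mat_powr_eq_mat_fun:
  assumes "hermitian A"
  shows "mat_powr A p = mat_fun (\<lambda>x. x powr p) A"
proof -
  obtain K :: "real set" and P where sd: "spectral_decomposition A K (\<lambda>x. x) P"
    using hermitian_spectral_decomposition[OF assms] by blast
  show ?thesis by (simp add: mat_powr_eq[OF sd] mat_fun_eq[OF sd])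
qed

lemma spectral_resolution:
  assumes sd: "spectral_decomposition A K lam P"
  shows "X = (\<Sum>k\<in>K. \<Sum>l\<in>K. P k ** X ** P l)"
proof -
  have "X = (\<Sum>k\<in>K. P k) ** X ** (\<Sum>l\<in>K. P l)"
    by (simp add: spectral_decomposition_sum[OF sd])
  also have "\<dots> = (\<Sum>l\<in>K. \<Sum>k\<in>K. P k ** X ** P l)"
    by (simp only: mmult.sum_left mmult.sum_right)
  finally show ?thesis by (subst sum.swap)
qed

text \<open>A matrix is the sum of its blocks. On a block, functions of \<open>A\<close> and
  \<open>mat_schur\<close> act as real scalars, so operator identities reduce to scalar
  ones.\<close>

lemma spectral_block_eqI:
  assumes sd: "spectral_decomposition A K lam P"
    and "\<And>k l. k \<in> K \<Longrightarrow> l \<in> K \<Longrightarrow> P k ** X ** P l = P k ** Y ** P l"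
  shows "X = Y"
proof -
  have "(\<Sum>k\<in>K. \<Sum>l\<in>K. P k ** X ** P l) = (\<Sum>k\<in>K. \<Sum>l\<in>K. P k ** Y ** P l)"
    by (intro sum.cong refl assms)
  then show ?thesis
    using spectral_resolution[OF sd, of X] spectral_resolution[OF sd, of Y] by simp
qed

lemma
  assumes sd: "spectral_decomposition A K lam P" and k: "k \<in> K"
  shows spectral_proj_mat_fun: "P k ** mat_fun f A = f (lam k) *\<^sub>R P k"
    and mat_fun_spectral_proj: "mat_fun f A ** P k = f (lam k) *\<^sub>R P k"
proof -
  note PP = spectral_decomposition_orthogonal[OF sd] and fin = spectral_decomposition_finite[OF sd]
  have "P k ** mat_fun f A = (\<Sum>l\<in>K. if k = l then f (lam k) *\<^sub>R P k else 0)"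
    unfolding mat_fun_eq[OF sd] mmult.sum_right
    using k by (intro sum.cong) (auto simp: matrix_scaleR_right PP)
  then show "P k ** mat_fun f A = f (lam k) *\<^sub>R P k" using k fin by simp
  have "mat_fun f A ** P k = (\<Sum>l\<in>K. if k = l then f (lam k) *\<^sub>R P k else 0)"
    unfolding mat_fun_eq[OF sd] mmult.sum_left
    using k by (intro sum.cong) (auto simp: matrix_scaleR_left PP)
  then show "mat_fun f A ** P k = f (lam k) *\<^sub>R P k" using k fin by simp
qed

lemma spectral_block_mat_schur:
  assumes sd: "spectral_decomposition A K lam P" and kl: "k \<in> K" "l \<in> K"
  shows "P k ** mat_schur psi A H ** P l = psi (lam k) (lam l) *\<^sub>R (P k ** H ** P l)"
proof -
  note PP = spectral_decomposition_orthogonal[OF sd] and fin = spectral_decomposition_finite[OF sd]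
  have "P k ** (P a ** H ** P b) ** P l = (if k = a then if l = b then P k ** H ** P l else 0 else 0)"
    if "a \<in> K" "b \<in> K" for a b
  proof -
    have "P k ** (P a ** H ** P b) ** P l = (P k ** P a) ** H ** (P b ** P l)"
      by (simp add: matrix_mul_assoc)
    then show ?thesis using that kl by (simp add: PP)
  qed
  then have "P k ** mat_schur psi A H ** P l =
      (\<Sum>a\<in>K. \<Sum>b\<in>K. if k = a then if l = b then psi (lam k) (lam l) *\<^sub>R (P k ** H ** P l) else 0 else 0)"
    unfolding mat_schur_eq[OF sd] mmult.sum_left mmult.sum_right
    by (intro sum.cong refl) (auto simp: matrix_scaleR_left matrix_scaleR_right)
  also have "\<dots> = (\<Sum>a\<in>K. if k = a then
      \<Sum>b\<in>K. if l = b then psi (lam k) (lam l) *\<^sub>R (P k ** H ** P l) else 0 else 0)"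
    by (intro sum.cong) auto
  also have "\<dots> = psi (lam k) (lam l) *\<^sub>R (P k ** H ** P l)"
    using kl fin by simp
  finally show ?thesis .
qed

lemma mat_fun_mult:
  assumes "hermitian A"
  shows "mat_fun f A ** mat_fun g A = mat_fun (\<lambda>x. f x * g x) A"
proof -
  obtain K :: "real set" and P where sd: "spectral_decomposition A K (\<lambda>x. x) P"
    using hermitian_spectral_decomposition[OF assms] by blast
  show ?thesis
  proof (rule spectral_block_eqI[OF sd])
    fix k l assume kl: "k \<in> K" "l \<in> K"
    have "P k ** (mat_fun f A ** mat_fun g A) ** P l = (P k ** mat_fun f A) ** (mat_fun g A ** P l)"
      by (simp add: matrix_mul_assoc)
    also have "\<dots> = P k ** mat_fun (\<lambda>x. f x * g x) A ** P l"
      using kl by (simp add: spectral_proj_mat_fun[OF sd] mat_fun_spectral_proj[OF sd]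
          matrix_scaleR_left matrix_scaleR_right spectral_decomposition_orthogonal[OF sd])
    finally show "P k ** (mat_fun f A ** mat_fun g A) ** P l =
      P k ** mat_fun (\<lambda>x. f x * g x) A ** P l" .
  qed
qed

lemma hermitian_mat_fun:
  assumes "hermitian A"
  shows "hermitian (mat_fun f A)"
proof -
  obtain K :: "real set" and P where sd: "spectral_decomposition A K (\<lambda>x. x) P"
    using hermitian_spectral_decomposition[OF assms] by blast
  show ?thesis
    unfolding hermitian_def mat_fun_eq[OF sd] cadjoint_sum cadjoint_scaleR
    by (simp add: spectral_decomposition_cadjoint[OF sd])
qed

text \<open>Against a function of \<open>A\<close> the trace sees only the diagonal blocks, so only
  the diagonal values of the symbol survive.\<close>

lemma trace_mat_fun_mult_mat_schur:
  assumes "hermitian A"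
  shows "trace (mat_fun g A ** mat_schur psi A H) = trace (mat_fun (\<lambda>x. g x * psi x x) A ** H)"
proof -
  obtain K :: "real set" and P where sd: "spectral_decomposition A K (\<lambda>x. x) P"
    using hermitian_spectral_decomposition[OF assms] by blast
  have *: "trace (P k ** X) = trace (P k ** X ** P k)" if "k \<in> K" for k X
    using trace_mult_commute[of "P k ** X" "P k"] that
    by (simp add: matrix_mul_assoc spectral_decomposition_orthogonal[OF sd])
  have block: "trace (P k ** mat_schur psi A H) = psi k k *\<^sub>R trace (P k ** H)" if "k \<in> K" for k
    unfolding *[OF that, of "mat_schur psi A H"] *[OF that, of H]
    by (simp only: spectral_block_mat_schur[OF sd that that] trace_scaleR)
  have "trace (mat_fun g A ** mat_schur psi A H) = (\<Sum>k\<in>K. g k *\<^sub>R trace (P k ** mat_schur psi A H))"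
    unfolding mat_fun_eq[OF sd] mmult.sum_left trace_sum_matrix
    by (simp add: matrix_scaleR_left trace_scaleR)
  also have "\<dots> = (\<Sum>k\<in>K. (g k * psi k k) *\<^sub>R trace (P k ** H))"
    by (intro sum.cong refl) (simp add: block)
  also have "\<dots> = trace (mat_fun (\<lambda>x. g x * psi x x) A ** H)"
    unfolding mat_fun_eq[OF sd] mmult.sum_left trace_sum_matrix
    by (simp add: matrix_scaleR_left trace_scaleR)
  finally show ?thesis .
qed

lemma spectral_decomposition_mat_fun:
  assumes sd: "spectral_decomposition A K lam P" and inj: "inj_on g (lam ` K)"
  shows "spectral_decomposition (mat_fun g A) K (\<lambda>k. g (lam k)) P"
proof -
  have "inj_on lam K"
    using sd unfolding spectral_decomposition_def by blast
  then have "inj_on (\<lambda>k. g (lam k)) K"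
    using comp_inj_on[OF _ inj] by (simp add: comp_def)
  then show ?thesis
    using sd mat_fun_eq[OF sd, of g] unfolding spectral_decomposition_def by (intro conjI) simp_all
qed

section \<open>Positive definite matrices and their spectra\<close>

lemma matrix_scaleR_vector: "(c *\<^sub>R A) *v v = c *\<^sub>R (A *v v)" for A :: "complex ^ 'n ^ 'n"
  by (simp add: vec_eq_iff matrix_vector_mult_def scaleR_sum_right)

lemma cinner_cadjoint: "cinner v (A *v w) = cinner (cadjoint A *v v) w"
proof -
  have "cinner v (A *v w) = (\<Sum>i\<in>UNIV. \<Sum>j\<in>UNIV. cnj (v $ i) * (A $ i $ j * w $ j))"
    by (simp add: cinner_def matrix_vector_mult_def sum_distrib_left)
  also have "\<dots> = (\<Sum>j\<in>UNIV. \<Sum>i\<in>UNIV. cnj (v $ i) * (A $ i $ j * w $ j))"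
    by (rule sum.swap)
  also have "\<dots> = cinner (cadjoint A *v v) w"
    by (simp add: cinner_def matrix_vector_mult_def cadjoint_def sum_distrib_right sum_distrib_left
        mult_ac)
  finally show ?thesis .
qed

lemma positive_definite_hermitian: "positive_definite A \<Longrightarrow> hermitian A"
  by (simp add: positive_definite_def)

lemma positive_definite_eigenvalue_pos:
  assumes A: "positive_definite A" and sd: "spectral_decomposition A K lam P" and k: "k \<in> K"
  shows "0 < lam k"
proof -
  have "P k \<noteq> 0" using spectral_decomposition_nonzero[OF sd k] .
  then obtain v where v: "P k *v v \<noteq> 0"
    by (metis matrix_eq matrix_vector_mult_0)
  let ?w = "P k *v v"
  have "A *v ?w = lam k *\<^sub>R ?w"
    using spectral_decomposition_mult(2)[OF sd k]
    by (simp add: matrix_vector_mul_assoc matrix_scaleR_vector)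
  moreover have "0 < Re (cinner ?w (A *v ?w))"
    using A v by (simp add: positive_definite_def)
  ultimately have "0 < lam k * Re (cinner ?w ?w)"
    by (simp add: cinner_def sum_distrib_left)
  moreover have "0 \<le> Re (cinner ?w ?w)"
    by (simp add: cinner_def sum_nonneg)
  ultimately show ?thesis
    by (metis less_le_not_le zero_less_mult_iff)
qed

lemma positive_definite_conjugate:
  assumes A: "positive_definite A" and S: "hermitian S" and inv: "T ** S = mat 1"
  shows "positive_definite (S ** A ** S)"
  unfolding positive_definite_def
proof (intro conjI allI impI)
  show "hermitian (S ** A ** S)"
    using S A by (simp add: positive_definite_def hermitian_def cadjoint_mult matrix_mul_assoc)
next
  fix v :: "complex ^ 'a" assume v: "v \<noteq> 0"
  have "T *v (S *v v) = v"
    by (simp add: matrix_vector_mul_assoc inv)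
  then have "S *v v \<noteq> 0"
    using v by (metis matrix_vector_mult_0_right)
  then have "0 < Re (cinner (S *v v) (A *v (S *v v)))"
    using A by (simp add: positive_definite_def)
  also have "cinner (S *v v) (A *v (S *v v)) = cinner v ((S ** A ** S) *v v)"
    using cinner_cadjoint[of v S "A *v (S *v v)"] S
    by (simp add: hermitian_def matrix_vector_mul_assoc matrix_mul_assoc)
  finally show "0 < Re (cinner v ((S ** A ** S) *v v))" .
qed

lemma positive_definite_spectral:
  assumes "positive_definite A"
  obtains K :: "real set" and P
  where "spectral_decomposition A K (\<lambda>x. x) P" "\<And>x. x \<in> K \<Longrightarrow> 0 < x"
proof -
  obtain K :: "real set" and P where "spectral_decomposition A K (\<lambda>x. x) P"
    using hermitian_spectral_decomposition[OF positive_definite_hermitian[OF assms]] by blast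
  then show ?thesis
    using positive_definite_eigenvalue_pos[OF assms] that by metis
qed

lemma mat_fun_cong_pos:
  assumes "positive_definite A" "\<And>x. 0 < x \<Longrightarrow> f x = g x"
  shows "mat_fun f A = mat_fun g A"
proof -
  obtain K :: "real set" and P where sd: "spectral_decomposition A K (\<lambda>x. x) P"
    and "\<And>x. x \<in> K \<Longrightarrow> 0 < x"
    using positive_definite_spectral[OF assms(1)] by blast
  then show ?thesis
    using assms(2) by (simp add: mat_fun_eq[OF sd])
qed

lemma mat_fun_const:
  assumes "hermitian A"
  shows "mat_fun (\<lambda>x. c) A = c *\<^sub>R mat 1"
proof -
  obtain K :: "real set" and P where sd: "spectral_decomposition A K (\<lambda>x. x) P"
    using hermitian_spectral_decomposition[OF assms] by blast
  show ?thesis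
    by (simp add: mat_fun_eq[OF sd] spectral_decomposition_sum[OF sd] flip: scaleR_sum_right)
qed

lemma trace_spectral_proj:
  assumes sd: "spectral_decomposition A K lam P" and k: "k \<in> K"
  shows "Re (trace (P k)) = (norm (P k))\<^sup>2"
  using k by (simp add: norm_matrix_eq_trace spectral_decomposition_cadjoint[OF sd]
      spectral_decomposition_orthogonal[OF sd])

lemma trace_mat_fun_pos:
  assumes "positive_definite A" "\<And>x. 0 < x \<Longrightarrow> 0 < f x"
  shows "0 < Re (trace (mat_fun f A))"
proof -
  obtain K :: "real set" and P where sd: "spectral_decomposition A K (\<lambda>x. x) P"
    and pos: "\<And>x. x \<in> K \<Longrightarrow> 0 < x"
    using positive_definite_spectral[OF assms(1)] by blast
  have "K \<noteq> {}"
  proof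
    assume "K = {}"
    then have "mat 1 = (0 :: complex ^ 'a ^ 'a)"
      using spectral_decomposition_sum[OF sd] by simp
    then have "mat 1 $ i $ i = (0 :: complex)" for i :: 'a
      by simp
    then show False by (simp add: mat_def)
  qed
  then have "0 < (\<Sum>k\<in>K. f k * (norm (P k))\<^sup>2)"
    using spectral_decomposition_finite[OF sd] spectral_decomposition_nonzero[OF sd] assms(2) pos
    by (intro sum_pos) auto
  also have "\<dots> = Re (trace (mat_fun f A))"
    by (simp add: mat_fun_eq[OF sd] trace_sum_matrix trace_scaleR trace_spectral_proj[OF sd])
  finally show ?thesis .
qed

section \<open>Perturbation of the spectrum and the Daleckii--Krein formula\<close>

text \<open>Derivatives of matrix functions are obtained from exact formulas for difference
  quotients, so they are needed in the form of a limit of such quotients.\<close>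

lemma has_vector_derivative_iff_tendsto:
  "(f has_vector_derivative D) (at a) \<longleftrightarrow> ((\<lambda>t. (f t - f a) /\<^sub>R (t - a)) \<longlongrightarrow> D) (at a)"
proof -
  have "(f has_vector_derivative D) (at a) \<longleftrightarrow>
      ((\<lambda>t. norm ((f t - f a) - (t - a) *\<^sub>R D) / norm (t - a)) \<longlongrightarrow> 0) (at a)"
    by (simp add: has_vector_derivative_def has_derivative_iff_norm bounded_linear_scaleR_left)
  also have "\<dots> \<longleftrightarrow> ((\<lambda>t. norm ((f t - f a) /\<^sub>R (t - a) - D)) \<longlongrightarrow> 0) (at a)"
  proof (rule filterlim_cong[OF refl refl], unfold eventually_at_topological, intro exI[of _ UNIV] conjI ballI impI)
    fix t :: real assume "t \<noteq> a"
    then have "(f t - f a) /\<^sub>R (t - a) - D = ((f t - f a) - (t - a) *\<^sub>R D) /\<^sub>R (t - a)"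
      unfolding scaleR_diff_right[of "inverse (t - a)" "f t - f a"] by simp
    then show "norm ((f t - f a) - (t - a) *\<^sub>R D) / norm (t - a) = norm ((f t - f a) /\<^sub>R (t - a) - D)"
      by (simp only: norm_scaleR real_norm_def abs_inverse divide_inverse_commute)
  qed auto
  also have "\<dots> \<longleftrightarrow> ((\<lambda>t. (f t - f a) /\<^sub>R (t - a)) \<longlongrightarrow> D) (at a)"
    unfolding tendsto_norm_zero_iff by (rule LIM_zero_iff)
  finally show ?thesis .
qed

text \<open>The constant must be independent of the matrix. Squared norms of the projections are
  their traces, which add up to the dimension and thus bound each projection. A nonzero idempotent
  has norm at least 1/c, with c the constant of submultiplicativity, which then bounds the number of
  projections.\<close>

lemma spectral_bounds:
  obtains C :: real where "1 \<le> C"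
    "\<And>(X :: complex ^ 'n ^ 'n) (Y :: complex ^ 'n ^ 'n). norm (X ** Y) \<le> C * norm X * norm Y"
    "\<And>(A :: complex ^ 'n ^ 'n) (K :: real set) P k.
       spectral_decomposition A K (\<lambda>x. x) P \<Longrightarrow> k \<in> K \<Longrightarrow> norm (P k) \<le> C"
    "\<And>(A :: complex ^ 'n ^ 'n) (K :: real set) P.
       spectral_decomposition A K (\<lambda>x. x) P \<Longrightarrow> real (card K) \<le> C"
proof -
  obtain c where c: "0 < c" "\<And>(X :: complex ^ 'n ^ 'n) (Y :: complex ^ 'n ^ 'n). norm (X ** Y) \<le> norm X * norm Y * c"
    using mmult.pos_bounded by blast
  define n where "n = real CARD('n)"
  have n: "1 \<le> n" by (simp add: n_def Suc_le_eq)
  have sum: "(\<Sum>k\<in>K. (norm (P k))\<^sup>2) = n"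
    if sd: "spectral_decomposition A K (\<lambda>x. x) P"
    for A :: "complex ^ 'n ^ 'n" and K :: "real set" and P
  proof -
    have "(\<Sum>k\<in>K. (norm (P k))\<^sup>2) = Re (trace (\<Sum>k\<in>K. P k))"
      by (simp add: trace_sum_matrix trace_spectral_proj[OF sd])
    also have "\<dots> = n"
      unfolding spectral_decomposition_sum[OF sd] by (simp add: trace_def mat_def n_def)
    finally show ?thesis .
  qed
  have bound: "norm (P k) \<le> n"
    if sd: "spectral_decomposition A K (\<lambda>x. x) P" and k: "k \<in> K"
    for A :: "complex ^ 'n ^ 'n" and K :: "real set" and P k
  proof (rule power2_le_imp_le)
    have "(norm (P k))\<^sup>2 \<le> n"
      using member_le_sum[OF k, of "\<lambda>k. (norm (P k))\<^sup>2"] spectral_decomposition_finite[OF sd]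
        sum[OF sd] by simp
    also have "\<dots> \<le> n\<^sup>2" using n by (simp add: power2_eq_square)
    finally show "(norm (P k))\<^sup>2 \<le> n\<^sup>2" .
  qed (use n in simp)
  have card: "real (card K) \<le> c\<^sup>2 * n"
    if sd: "spectral_decomposition A K (\<lambda>x. x) P"
    for A :: "complex ^ 'n ^ 'n" and K :: "real set" and P
  proof -
    have "1 \<le> c\<^sup>2 * (norm (P k))\<^sup>2" if k: "k \<in> K" for k
    proof -
      have "norm (P k) * 1 \<le> norm (P k) * (norm (P k) * c)"
        using c(2)[of "P k" "P k"] k
        by (simp add: spectral_decomposition_orthogonal[OF sd] mult.assoc)
      then have "1 \<le> c * norm (P k)"
        using spectral_decomposition_nonzero[OF sd k] by (simp add: mult.commute)
      then show ?thesis
        by (metis one_le_power power_mult_distrib)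
    qed
    then have "(\<Sum>k\<in>K. 1) \<le> (\<Sum>k\<in>K. c\<^sup>2 * (norm (P k))\<^sup>2)"
      by (intro sum_mono)
    then show ?thesis
      by (simp add: sum[OF sd] flip: sum_distrib_left)
  qed
  let ?C = "max 1 (max c (max n (c\<^sup>2 * n)))"
  show thesis
  proof (rule that[of ?C])
    show "1 \<le> ?C" by simp
    show "norm (X ** Y) \<le> ?C * norm X * norm Y" for X Y :: "complex ^ 'n ^ 'n"
    proof -
      have "norm (X ** Y) \<le> c * (norm X * norm Y)"
        using c(2)[of X Y] by (simp add: mult_ac)
      also have "\<dots> \<le> ?C * (norm X * norm Y)"
        by (intro mult_right_mono) auto
      finally show ?thesis by (simp add: mult_ac)
    qed
    show "norm (P k) \<le> ?C"
      if "spectral_decomposition A K (\<lambda>x. x) P" "k \<in> K"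
      for A :: "complex ^ 'n ^ 'n" and K :: "real set" and P k
      using bound[OF that] by simp
    show "real (card K) \<le> ?C"
      if "spectral_decomposition A K (\<lambda>x. x) P"
      for A :: "complex ^ 'n ^ 'n" and K :: "real set" and P
      using card[OF that] by simp
  qed
qed

lemma norm_sum_le_card_bound:
  fixes f :: "'a \<Rightarrow> 'b :: real_normed_vector"
  assumes "\<And>x. x \<in> S \<Longrightarrow> norm (f x) \<le> b" "real (card S) \<le> C" "0 \<le> b"
  shows "norm (sum f S) \<le> C * b"
  using sum_norm_bound[of S f b] assms mult_right_mono[of "real (card S)" C b] by force

lemma spectral_pair_identity:
  assumes A: "spectral_decomposition A K lam P" "k \<in> K"
    and B: "spectral_decomposition B M mu Q" "m \<in> M"
  shows "P k ** (B - A) ** Q m = (mu m - lam k) *\<^sub>R (P k ** Q m)"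
proof -
  have "P k ** (B - A) ** Q m = P k ** (B ** Q m) - (P k ** A) ** Q m"
    by (simp add: mmult.diff_left mmult.diff_right matrix_mul_assoc)
  then show ?thesis
    by (simp add: spectral_decomposition_mult[OF A] spectral_decomposition_mult[OF B]
        matrix_scaleR_left matrix_scaleR_right scaleR_diff_left)
qed

text \<open>
  Eigenprojections of \<open>A\<close> and \<open>B\<close> belonging to eigenvalues at distance \<open>r\<close> have a product of norm
  \<open>O(norm (B - A) / r)\<close>; this controls both the spectrum of \<open>B\<close> and the operators \<open>mat_schur\<close>.
\<close>

lemma spectral_perturbation:
  obtains C :: real where "1 \<le> C"
    "\<And>(A :: complex ^ 'n ^ 'n) (B :: complex ^ 'n ^ 'n) (K :: real set) (M :: real set) P Q m.
       spectral_decomposition A K (\<lambda>x. x) P \<Longrightarrow> spectral_decomposition B M (\<lambda>x. x) Q \<Longrightarrow> m \<in> M \<Longrightarrow>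
       \<exists>k\<in>K. \<bar>m - k\<bar> \<le> C * norm (B - A)"
    "\<And>(A :: complex ^ 'n ^ 'n) (B :: complex ^ 'n ^ 'n) (K :: real set) (M :: real set) P Q psi e c H.
       spectral_decomposition A K (\<lambda>x. x) P \<Longrightarrow> spectral_decomposition B M (\<lambda>x. x) Q \<Longrightarrow>
       0 \<le> e \<Longrightarrow> 0 \<le> c \<Longrightarrow>
       (\<And>k l x y. k \<in> K \<Longrightarrow> l \<in> K \<Longrightarrow> x \<in> M \<Longrightarrow> y \<in> M \<Longrightarrow>
          \<bar>psi x y - psi k l\<bar> \<le> e + c * (\<bar>x - k\<bar> + \<bar>y - l\<bar>)) \<Longrightarrow>
       norm (mat_schur psi B H - mat_schur psi A H) \<le> C * (e + c * norm (B - A)) * norm H"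
proof -
  obtain C :: real where C1: "1 \<le> C"
    and mul: "\<And>(X :: complex ^ 'n ^ 'n) (Y :: complex ^ 'n ^ 'n). norm (X ** Y) \<le> C * norm X * norm Y"
    and proj: "\<And>(A :: complex ^ 'n ^ 'n) (K :: real set) P k.
       spectral_decomposition A K (\<lambda>x. x) P \<Longrightarrow> k \<in> K \<Longrightarrow> norm (P k) \<le> C"
    and card: "\<And>(A :: complex ^ 'n ^ 'n) (K :: real set) P.
       spectral_decomposition A K (\<lambda>x. x) P \<Longrightarrow> real (card K) \<le> C"
    using spectral_bounds[where 'n = 'n] by blast
  have C0: "0 \<le> C" using C1 by simp
  have mul3: "norm (X ** Y ** Z) \<le> C\<^sup>2 * norm X * norm Y * norm Z" for X Y Z :: "complex ^ 'n ^ 'n"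
  proof -
    have "norm (X ** Y ** Z) \<le> C * norm (X ** Y) * norm Z" by (rule mul)
    also have "\<dots> \<le> C * (C * norm X * norm Y) * norm Z"
      by (intro mult_right_mono mult_left_mono mul C0) auto
    finally show ?thesis by (simp add: power2_eq_square mult_ac)
  qed
  have pair: "\<bar>m - k\<bar> * norm (P k ** Q m) \<le> C ^ 3 * norm (B - A) * norm (Q m)"
    if A: "spectral_decomposition A K (\<lambda>x. x) P" and k: "k \<in> K"
      and B: "spectral_decomposition B M (\<lambda>x. x) Q" and m: "m \<in> M"
    for A B :: "complex ^ 'n ^ 'n" and K M :: "real set" and P Q k m
  proof -
    have "\<bar>m - k\<bar> * norm (P k ** Q m) = norm (P k ** (B - A) ** Q m)"
      using spectral_pair_identity[OF A k B m] by simp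
    also have "\<dots> \<le> C\<^sup>2 * norm (P k) * norm (B - A) * norm (Q m)"
      by (rule mul3)
    also have "\<dots> \<le> C\<^sup>2 * C * norm (B - A) * norm (Q m)"
      by (intro mult_right_mono mult_left_mono proj[OF A k]) auto
    finally show ?thesis by (simp add: power2_eq_square power3_eq_cube mult_ac)
  qed
  \<comment> \<open>In the second estimate each of four sums over projections costs a factor
    \<open>C\<close>, and a single term is bounded with 2 C^9; the first estimate only needs
    C^4.\<close>
  let ?D = "2 * C ^ 13"
  have le: "C ^ i \<le> C ^ j" if "i \<le> j" for i j
    using C1 that by (rule power_increasing[rotated])
  show thesis
  proof (rule that[of ?D])
    show "1 \<le> ?D"
      using one_le_power[OF C1, of 13] by linarith
  next
    fix A B :: "complex ^ 'n ^ 'n" and K M :: "real set" and P Q m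
    assume A: "spectral_decomposition A K (\<lambda>x. x) P" and B: "spectral_decomposition B M (\<lambda>x. x) Q"
      and m: "m \<in> M"
    have Qm: "Q m = (\<Sum>k\<in>K. P k ** Q m)"
      by (simp add: spectral_decomposition_sum[OF A] flip: mmult.sum_left)
    have fin: "finite K" by (rule spectral_decomposition_finite[OF A])
    have ne: "K \<noteq> {}"
      using Qm spectral_decomposition_nonzero[OF B m] by auto
    \<comment> \<open>The distance of m from the spectrum of \<open>A\<close>. It is at most every
      individual distance, so the bounds for the products \<open>P k ** Q m\<close> can be summed
      with one common factor; cancelling the nonzero norm of \<open>Q m\<close> finishes.\<close>
    let ?r = "Min ((\<lambda>k. \<bar>m - k\<bar>) ` K)"
    have r0: "0 \<le> ?r" using fin ne by simp
    have "?r * norm (Q m) = norm (\<Sum>k\<in>K. ?r *\<^sub>R (P k ** Q m))"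
      using r0 by (simp add: Qm[symmetric] flip: scaleR_sum_right)
    also have "\<dots> \<le> C * (C ^ 3 * norm (B - A) * norm (Q m))"
    proof (rule norm_sum_le_card_bound[OF _ card[OF A]])
      fix k assume k: "k \<in> K"
      have "norm (?r *\<^sub>R (P k ** Q m)) = ?r * norm (P k ** Q m)"
        using r0 by simp
      also have "\<dots> \<le> \<bar>m - k\<bar> * norm (P k ** Q m)"
        using fin k by (intro mult_right_mono) auto
      also have "\<dots> \<le> C ^ 3 * norm (B - A) * norm (Q m)"
        by (rule pair[OF A k B m])
      finally show "norm (?r *\<^sub>R (P k ** Q m)) \<le> C ^ 3 * norm (B - A) * norm (Q m)" .
    qed (use C0 in simp)
    finally have "?r * norm (Q m) \<le> (C ^ 4 * norm (B - A)) * norm (Q m)"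
      by (simp add: power_numeral_reduce mult_ac)
    then have "?r \<le> C ^ 4 * norm (B - A)"
      using spectral_decomposition_nonzero[OF B m] by simp
    also have "\<dots> \<le> ?D * norm (B - A)"
    proof (rule mult_right_mono)
      show "C ^ 4 \<le> ?D"
        using le[of 4 13, simplified] zero_le_power[OF C0, of 13] by linarith
    qed simp
    finally have "?r \<le> ?D * norm (B - A)" .
    moreover have "?r \<in> (\<lambda>k. \<bar>m - k\<bar>) ` K"
      using fin ne by (intro Min_in) auto
    ultimately show "\<exists>k\<in>K. \<bar>m - k\<bar> \<le> ?D * norm (B - A)"
      by auto
  next
    fix A B :: "complex ^ 'n ^ 'n" and K M :: "real set" and P Q psi and e c :: real and H
    assume A: "spectral_decomposition A K (\<lambda>x. x) P" and B: "spectral_decomposition B M (\<lambda>x. x) Q"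
      and e: "0 \<le> e" and c: "0 \<le> c"
      and psi: "\<And>k l x y. k \<in> K \<Longrightarrow> l \<in> K \<Longrightarrow> x \<in> M \<Longrightarrow> y \<in> M \<Longrightarrow>
          \<bar>psi x y - psi k l\<bar> \<le> e + c * (\<bar>x - k\<bar> + \<bar>y - l\<bar>)"
    let ?d = "norm (B - A)"
    \<comment> \<open>Inserting the projections of \<open>A\<close> around the sum for
      \<open>B\<close>, and those of \<open>B\<close> around \<open>H\<close> in the sum for
      \<open>A\<close>, produces the same quadruple sum of operators. The two sides then differ only
      in the scalar coefficients.\<close>
    have schur_B: "mat_schur psi B H =
        (\<Sum>k\<in>K. \<Sum>l\<in>K. \<Sum>m\<in>M. \<Sum>n\<in>M. psi m n *\<^sub>R (P k ** Q m ** H ** (Q n ** P l)))"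
    proof -
      have "mat_schur psi B H =
          (\<Sum>k\<in>K. \<Sum>l\<in>K. P k ** (\<Sum>m\<in>M. \<Sum>n\<in>M. psi m n *\<^sub>R (Q m ** H ** Q n)) ** P l)"
        using spectral_resolution[OF A, of "mat_schur psi B H"] mat_schur_eq[OF B, of psi H] by simp
      then show ?thesis
        by (simp only: mmult.sum_left mmult.sum_right matrix_scaleR_left matrix_scaleR_right
            matrix_mul_assoc)
    qed
    have schur_A: "mat_schur psi A H =
        (\<Sum>k\<in>K. \<Sum>l\<in>K. \<Sum>m\<in>M. \<Sum>n\<in>M. psi k l *\<^sub>R (P k ** Q m ** H ** (Q n ** P l)))"
    proof -
      have "mat_schur psi A H =
          (\<Sum>k\<in>K. \<Sum>l\<in>K. psi k l *\<^sub>R (P k ** (\<Sum>m\<in>M. \<Sum>n\<in>M. Q m ** H ** Q n) ** P l))"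
        using spectral_resolution[OF B, of H] mat_schur_eq[OF A, of psi H] by simp
      then show ?thesis
        by (simp only: mmult.sum_left mmult.sum_right scaleR_sum_right matrix_mul_assoc)
    qed
    let ?T = "\<lambda>k l m n. (psi m n - psi k l) *\<^sub>R (P k ** Q m ** H ** (Q n ** P l))"
    have diff: "mat_schur psi B H - mat_schur psi A H = (\<Sum>k\<in>K. \<Sum>l\<in>K. \<Sum>m\<in>M. \<Sum>n\<in>M. ?T k l m n)"
      by (simp add: schur_A schur_B scaleR_diff_left sum_subtractf)
    let ?b = "2 * C ^ 9 * (e + c * ?d) * norm H"
    have b0: "0 \<le> ?b" using C0 e c by simp
    have term_bound: "norm (?T k l m n) \<le> ?b"
      if k: "k \<in> K" and l: "l \<in> K" and m: "m \<in> M" and n: "n \<in> M" for k l m n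
    proof -
      let ?w = "norm (P k ** Q m)" and ?v = "norm (Q n ** P l)"
      have w: "?w \<le> C ^ 3"
      proof -
        have "?w \<le> C * norm (P k) * norm (Q m)" by (rule mul)
        also have "\<dots> \<le> C * C * C"
          using C0 by (intro mult_mono proj[OF A k] proj[OF B m]) auto
        finally show ?thesis by (simp add: power3_eq_cube)
      qed
      have v: "?v \<le> C ^ 3"
      proof -
        have "?v \<le> C * norm (Q n) * norm (P l)" by (rule mul)
        also have "\<dots> \<le> C * C * C"
          using C0 by (intro mult_mono proj[OF A l] proj[OF B n]) auto
        finally show ?thesis by (simp add: power3_eq_cube)
      qed
      have mw: "\<bar>m - k\<bar> * ?w \<le> C ^ 4 * ?d"
      proof -
        have "\<bar>m - k\<bar> * ?w \<le> C ^ 3 * ?d * norm (Q m)" by (rule pair[OF A k B m])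
        also have "\<dots> \<le> C ^ 3 * ?d * C"
          using C0 by (intro mult_left_mono proj[OF B m]) auto
        finally show ?thesis by (simp add: power_numeral_reduce mult_ac)
      qed
      have nv: "\<bar>n - l\<bar> * ?v \<le> C ^ 4 * ?d"
      proof -
        have "\<bar>l - n\<bar> * ?v \<le> C ^ 3 * norm (A - B) * norm (P l)" by (rule pair[OF B n A l])
        also have "\<dots> \<le> C ^ 3 * norm (A - B) * C"
          using C0 by (intro mult_left_mono proj[OF A l]) auto
        finally show ?thesis
          by (simp add: power_numeral_reduce mult_ac norm_minus_commute abs_minus_commute)
      qed
      have "\<bar>psi m n - psi k l\<bar> * (?w * ?v) \<le> (e + c * (\<bar>m - k\<bar> + \<bar>n - l\<bar>)) * (?w * ?v)"
        by (intro mult_right_mono psi k l m n) auto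
      \<comment> \<open>Each eigenvalue distance is absorbed by the projection product with the same
        indices, at the price of one factor norm(B - A); the other product is merely
        bounded.\<close>
      also have "\<dots> = e * (?w * ?v) + c * ((\<bar>m - k\<bar> * ?w) * ?v) + c * (?w * (\<bar>n - l\<bar> * ?v))"
        by (simp add: algebra_simps)
      also have "\<dots> \<le> e * (C ^ 3 * C ^ 3) + c * ((C ^ 4 * ?d) * C ^ 3) + c * (C ^ 3 * (C ^ 4 * ?d))"
        using C0 by (intro add_mono mult_left_mono mult_mono w v mw nv e c) auto
      also have "\<dots> = e * C ^ 6 + 2 * (c * ?d) * C ^ 7"
        by (simp add: power_numeral_reduce algebra_simps)
      also have "\<dots> \<le> (2 * e) * C ^ 7 + 2 * (c * ?d) * C ^ 7"
        using le[of 6 7] e c C0 by (intro add_mono mult_mono) auto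
      finally have psi_wv: "\<bar>psi m n - psi k l\<bar> * (?w * ?v) \<le> 2 * C ^ 7 * (e + c * ?d)"
        by (simp add: algebra_simps)
      have "norm (?T k l m n) \<le> \<bar>psi m n - psi k l\<bar> * (C\<^sup>2 * ?w * norm H * ?v)"
        unfolding norm_scaleR by (intro mult_left_mono mul3) auto
      also have "\<dots> = (\<bar>psi m n - psi k l\<bar> * (?w * ?v)) * (C\<^sup>2 * norm H)"
        by (simp add: mult_ac)
      also have "\<dots> \<le> 2 * C ^ 7 * (e + c * ?d) * (C\<^sup>2 * norm H)"
        by (intro mult_right_mono psi_wv) auto
      finally show ?thesis
        by (simp add: power_numeral_reduce mult_ac)
    qed
    have "norm (mat_schur psi B H - mat_schur psi A H) \<le> C * (C * (C * (C * ?b)))"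
      unfolding diff
      using C0
      by (intro norm_sum_le_card_bound[OF _ card[OF A]] norm_sum_le_card_bound[OF _ card[OF B]]
          term_bound) (simp_all add: e c)
    then show "norm (mat_schur psi B H - mat_schur psi A H) \<le> ?D * (e + c * ?d) * norm H"
      by (simp add: power_numeral_reduce mult_ac)
  qed
qed

text \<open>A continuous symbol need not be Lipschitz, but up to an error e it behaves so on a
  compact square: nearby points are handled by uniform continuity at scale d, and beyond that scale
  the slope 2 N / d dominates the oscillation of a function bounded by N.\<close>

lemma uniform_modulus:
  fixes psi :: "real \<Rightarrow> real \<Rightarrow> real"
  assumes S: "compact S" and cont: "continuous_on (S \<times> S) (\<lambda>(x, y). psi x y)" and e: "0 < e"
  obtains c where "0 \<le> c"
    "\<And>x y k l. x \<in> S \<Longrightarrow> y \<in> S \<Longrightarrow> k \<in> S \<Longrightarrow> l \<in> S \<Longrightarrow>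
       \<bar>psi x y - psi k l\<bar> \<le> e + c * (\<bar>x - k\<bar> + \<bar>y - l\<bar>)"
proof -
  have comp: "compact (S \<times> S)" using S by (intro compact_Times)
  have "uniformly_continuous_on (S \<times> S) (\<lambda>(x, y). psi x y)"
    by (rule compact_uniformly_continuous[OF cont comp])
  then obtain d where d: "0 < d" and unif: "\<And>p q. p \<in> S \<times> S \<Longrightarrow> q \<in> S \<times> S \<Longrightarrow> dist q p < d \<Longrightarrow>
      dist ((\<lambda>(x, y). psi x y) q) ((\<lambda>(x, y). psi x y) p) < e"
    using e unfolding uniformly_continuous_on_def by meson
  obtain N where N: "\<And>p. p \<in> S \<times> S \<Longrightarrow> norm ((\<lambda>(x, y). psi x y) p) \<le> N"
    using compact_imp_bounded[OF compact_continuous_image[OF cont comp]]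
    unfolding bounded_iff by blast
  have N': "\<bar>psi x y\<bar> \<le> max 0 N" if "x \<in> S" "y \<in> S" for x y
    using N[of "(x, y)"] that by simp
  show thesis
  proof (rule that[of "2 * max 0 N / d"])
    show "0 \<le> 2 * max 0 N / d" using d by simp
    fix x y k l assume S: "x \<in> S" "y \<in> S" "k \<in> S" "l \<in> S"
    let ?s = "\<bar>x - k\<bar> + \<bar>y - l\<bar>"
    show "\<bar>psi x y - psi k l\<bar> \<le> e + 2 * max 0 N / d * ?s"
    proof (cases "?s < d")
      case True
      have "dist (x, y) (k, l) \<le> ?s"
        by (simp add: dist_Pair_Pair dist_real_def sqrt_sum_squares_le_sum_abs)
      then have "\<bar>psi x y - psi k l\<bar> < e"
        using unif[of "(k, l)" "(x, y)"] S True by (simp add: dist_real_def)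
      moreover have "0 \<le> 2 * max 0 N / d * ?s" using d by simp
      ultimately show ?thesis by linarith
    next
      case False
      have "\<bar>psi x y - psi k l\<bar> \<le> 2 * max 0 N"
        using N'[OF S(1,2)] N'[OF S(3,4)] by linarith
      also have "\<dots> = 2 * max 0 N / d * d" using d by simp
      also have "\<dots> \<le> 2 * max 0 N / d * ?s"
        using False d by (intro mult_left_mono) auto
      finally show ?thesis using e by linarith
    qed
  qed
qed

lemma mat_schur_tendsto_right:
  assumes "hermitian A" "(H \<longlongrightarrow> H0) F"
  shows "((\<lambda>x. mat_schur psi A (H x)) \<longlongrightarrow> mat_schur psi A H0) F"
proof -
  obtain K :: "real set" and P where sd: "spectral_decomposition A K (\<lambda>x. x) P"
    using hermitian_spectral_decomposition[OF assms(1)] by blast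
  show ?thesis
    unfolding mat_schur_eq[OF sd] by (intro tendsto_intros mmult.tendsto assms(2))
qed

lemma mat_schur_uniform_continuity:
  fixes A :: "complex ^ 'n ^ 'n"
  assumes A: "positive_definite A"
    and cont: "continuous_on ({0<..} \<times> {0<..}) (\<lambda>(x, y). psi x y)" and e: "0 < e"
  obtains d where "0 < d" "\<And>B H. positive_definite B \<Longrightarrow> norm (B - A) < d \<Longrightarrow>
    norm (mat_schur psi B H - mat_schur psi A H) \<le> e * norm H"
proof -
  obtain C where C1: "1 \<le> C"
    and near: "\<And>(A :: complex ^ 'n ^ 'n) (B :: complex ^ 'n ^ 'n) (K :: real set) (M :: real set) P Q m.
       spectral_decomposition A K (\<lambda>x. x) P \<Longrightarrow> spectral_decomposition B M (\<lambda>x. x) Q \<Longrightarrow> m \<in> M \<Longrightarrow>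
       \<exists>k\<in>K. \<bar>m - k\<bar> \<le> C * norm (B - A)"
    and est: "\<And>(A :: complex ^ 'n ^ 'n) (B :: complex ^ 'n ^ 'n) (K :: real set) (M :: real set) P Q psi e c H.
       spectral_decomposition A K (\<lambda>x. x) P \<Longrightarrow> spectral_decomposition B M (\<lambda>x. x) Q \<Longrightarrow>
       0 \<le> e \<Longrightarrow> 0 \<le> c \<Longrightarrow>
       (\<And>k l x y. k \<in> K \<Longrightarrow> l \<in> K \<Longrightarrow> x \<in> M \<Longrightarrow> y \<in> M \<Longrightarrow>
          \<bar>psi x y - psi k l\<bar> \<le> e + c * (\<bar>x - k\<bar> + \<bar>y - l\<bar>)) \<Longrightarrow>
       norm (mat_schur psi B H - mat_schur psi A H) \<le> C * (e + c * norm (B - A)) * norm H"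
    using spectral_perturbation[where 'n = 'n] by blast
  obtain K :: "real set" and P where sd: "spectral_decomposition A K (\<lambda>x. x) P"
    and pos: "\<And>x. x \<in> K \<Longrightarrow> 0 < x"
    using positive_definite_spectral[OF A] by blast
  have fin: "finite K" by (rule spectral_decomposition_finite[OF sd])
  \<comment> \<open>Half the distance from the spectrum to 0, capped by inserting 1, which also
    keeps \<open>Min\<close> and \<open>Max\<close> on a nonempty set. Moving an eigenvalue by less
    than \<open>a\<close> keeps it in the positive interval from \<open>a\<close> to
    \<open>b\<close>.\<close>
  define a where "a = Min (insert 1 K) / 2"
  define b where "b = Max (insert 1 K) + a"
  have a: "0 < a" using fin pos by (simp add: a_def)
  have K: "2 * a \<le> k" "k \<le> b - a" if "k \<in> K" for k
    using fin that by (auto simp: a_def b_def)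
  have "continuous_on ({a..b} \<times> {a..b}) (\<lambda>(x, y). psi x y)"
    using a by (intro continuous_on_subset[OF cont]) auto
  then obtain c where c: "0 \<le> c"
    and mod: "\<And>x y k l. x \<in> {a..b} \<Longrightarrow> y \<in> {a..b} \<Longrightarrow> k \<in> {a..b} \<Longrightarrow> l \<in> {a..b} \<Longrightarrow>
       \<bar>psi x y - psi k l\<bar> \<le> e / (2 * C) + c * (\<bar>x - k\<bar> + \<bar>y - l\<bar>)"
    using uniform_modulus[of "{a..b}" psi "e / (2 * C)"] e C1 by auto
  \<comment> \<open>The first bound keeps the eigenvalues of \<open>B\<close> within
    \<open>a\<close> of those of \<open>A\<close>; the second makes the linear part of the modulus
    at most e / (2 C). The summand 1 covers the case c = 0.\<close>
  define d where "d = min (a / C) (e / (2 * C * (c + 1)))"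
  show thesis
  proof (rule that[of d])
    show "0 < d" using a e c C1 by (simp add: d_def)
    fix B H :: "complex ^ 'n ^ 'n"
    assume B: "positive_definite B" and dist: "norm (B - A) < d"
    obtain M :: "real set" and Q where sdB: "spectral_decomposition B M (\<lambda>x. x) Q"
      using positive_definite_spectral[OF B] by blast
    have KS: "k \<in> {a..b}" if "k \<in> K" for k
      using K[OF that] a by auto
    have MS: "m \<in> {a..b}" if m: "m \<in> M" for m
    proof -
      obtain k where k: "k \<in> K" "\<bar>m - k\<bar> \<le> C * norm (B - A)"
        using near[OF sd sdB m] by blast
      have "norm (B - A) < a / C" using dist by (simp add: d_def)
      then have "C * norm (B - A) < a" using C1 by (simp add: field_simps)
      then show ?thesis using k(2) K[OF k(1)] by auto
    qed
    have "norm (mat_schur psi B H - mat_schur psi A H) \<le> C * (e / (2 * C) + c * norm (B - A)) * norm H"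
      using e C1 c KS MS by (intro est[OF sd sdB] mod) auto
    also have "\<dots> \<le> e * norm H"
    proof (rule mult_right_mono)
      have "c * norm (B - A) \<le> (c + 1) * (e / (2 * C * (c + 1)))"
        using dist c by (intro mult_mono) (auto simp: d_def)
      also have "\<dots> = e / (2 * C)"
        using mult_divide_mult_cancel_left[of "c + 1" e "2 * C"] c by (simp add: mult_ac)
      finally have "C * (e / (2 * C) + c * norm (B - A)) \<le> C * (e / (2 * C) + e / (2 * C))"
        using C1 by (intro mult_left_mono) auto
      also have "\<dots> = e" using C1 by (simp add: field_simps)
      finally show "C * (e / (2 * C) + c * norm (B - A)) \<le> e" .
    qed simp
    finally show "norm (mat_schur psi B H - mat_schur psi A H) \<le> e * norm H" .
  qed
qed

text \<open>Continuity holds jointly in the matrix and the operand, because the estimate near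
  \<open>A\<close> is proportional to the norm of the operand. Projections may be discontinuous at
  eigenvalue crossings, but there a continuous symbol takes nearly equal values on the merging
  eigenvalues.\<close>

theorem mat_schur_tendsto:
  fixes A :: "complex ^ 'n ^ 'n"
  assumes A: "positive_definite A"
    and cont: "continuous_on ({0<..} \<times> {0<..}) (\<lambda>(x, y). psi x y)"
    and B: "\<And>t. positive_definite (B t)" and lim: "(B \<longlongrightarrow> A) F" and H: "(H \<longlongrightarrow> H0) F"
  shows "((\<lambda>t. mat_schur psi (B t) (H t)) \<longlongrightarrow> mat_schur psi A H0) F"
proof -
  have "((\<lambda>t. mat_schur psi (B t) (H t) - mat_schur psi A (H t)) \<longlongrightarrow> 0) F"
  proof (rule tendstoI)
    fix e :: real assume e: "0 < e"
    define e' where "e' = e / (2 * (norm H0 + 1))"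
    have n: "0 < norm H0 + 1" by (simp add: add_nonneg_pos)
    have e': "0 < e'" using e n by (simp add: e'_def)
    obtain d where d: "0 < d" and est: "\<And>B H. positive_definite B \<Longrightarrow> norm (B - A) < d \<Longrightarrow>
        norm (mat_schur psi B H - mat_schur psi A H) \<le> e' * norm H"
      using mat_schur_uniform_continuity[OF A cont e'] by blast
    have "eventually (\<lambda>t. norm (B t - A) < d) F"
      using tendstoD[OF lim d] by (simp add: dist_norm)
    moreover have "eventually (\<lambda>t. norm (H t) < norm H0 + 1) F"
      using order_tendstoD(2)[OF tendsto_norm[OF H]] by simp
    ultimately show "eventually (\<lambda>t. dist (mat_schur psi (B t) (H t) - mat_schur psi A (H t)) 0 < e) F"
    proof eventually_elim
      case (elim t)
      have "norm (mat_schur psi (B t) (H t) - mat_schur psi A (H t)) \<le> e' * norm (H t)"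
        by (rule est[OF B elim(1)])
      also have "\<dots> \<le> e' * (norm H0 + 1)"
        using e' elim(2) by (intro mult_left_mono) auto
      also have "\<dots> = e / 2" using n unfolding e'_def by (simp add: divide_simps)
      also have "\<dots> < e" using e by simp
      finally show ?case by simp
    qed
  qed
  from tendsto_add[OF this mat_schur_tendsto_right[OF positive_definite_hermitian[OF A] H, of psi]]
  show ?thesis by simp
qed

section \<open>Divided differences and derivatives of matrix functions\<close>

definition divided_difference :: "(real \<Rightarrow> real) \<Rightarrow> (real \<Rightarrow> real) \<Rightarrow> real \<Rightarrow> real \<Rightarrow> real" where
  "divided_difference f f' x y = (if x = y then f' x else (f x - f y) / (x - y))"

lemma divided_difference_commute: "divided_difference f f' x y = divided_difference f f' y x"
  by (simp add: divided_difference_def divide_simps) (simp add: algebra_simps)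

lemma divided_difference_mean_value:
  assumes f: "\<And>x. 0 < x \<Longrightarrow> (f has_real_derivative f' x) (at x)" and "0 < x" "0 < y"
  shows "\<exists>z. min x y \<le> z \<and> z \<le> max x y \<and> divided_difference f f' x y = f' z"
proof -
  have lt: "\<exists>z. min x y \<le> z \<and> z \<le> max x y \<and> divided_difference f f' x y = f' z"
    if "0 < x" "x < y" for x y
  proof -
    have "\<exists>z>x. z < y \<and> f y - f x = (y - x) * f' z"
      using MVT2[OF that(2), of f f'] f that(1) by force
    then obtain z where "x < z" "z < y" "f y - f x = (y - x) * f' z"
      by blast
    then show ?thesis
      using that divided_difference_commute[of f f' x y]
      by (intro exI[of _ z]) (auto simp: divided_difference_def)
  qed
  consider "x < y" | "x = y" | "y < x" by linarith
  then show ?thesis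
  proof cases
    case 1
    then show ?thesis using lt assms by blast
  next
    case 2
    then show ?thesis by (auto simp: divided_difference_def)
  next
    case 3
    then show ?thesis
      using lt[of y x] assms divided_difference_commute[of f f' x y]
      by (simp add: min.commute max.commute)
  qed
qed

text \<open>Only diagonal points are delicate. There the mean value theorem writes every nearby
  value as f' at a point between the two arguments, so continuity of f' takes over.\<close>

lemma continuous_on_divided_difference:
  assumes f: "\<And>x. 0 < x \<Longrightarrow> (f has_real_derivative f' x) (at x)" and f': "continuous_on {0<..} f'"
  shows "continuous_on ({0<..} \<times> {0<..}) (\<lambda>(x, y). divided_difference f f' x y)"
  unfolding continuous_on_def
proof (intro ballI)
  fix p :: "real \<times> real" assume p: "p \<in> {0<..} \<times> {0<..}"
  obtain a b where ab: "p = (a, b)" "0 < a" "0 < b" using p by auto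
  let ?F = "at p within {0<..} \<times> {0<..}"
  have fst: "(fst \<longlongrightarrow> a) ?F" and snd: "(snd \<longlongrightarrow> b) ?F"
    using tendsto_fst[OF tendsto_ident_at, of p "{0<..} \<times> {0<..}"]
      tendsto_snd[OF tendsto_ident_at, of p "{0<..} \<times> {0<..}"] by (simp_all add: ab)
  have "((\<lambda>q. divided_difference f f' (fst q) (snd q)) \<longlongrightarrow> divided_difference f f' a b) ?F"
  proof (cases "a = b")
    case False
    have "(f \<longlongrightarrow> f a) (at a)" "(f \<longlongrightarrow> f b) (at b)"
      using f[OF ab(2)] f[OF ab(3)] by (auto dest!: DERIV_isCont simp: isCont_def)
    then have "((\<lambda>q. f (fst q)) \<longlongrightarrow> f a) ?F" "((\<lambda>q. f (snd q)) \<longlongrightarrow> f b) ?F"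
      using tendsto_compose[OF _ fst] tendsto_compose[OF _ snd] by auto
    then have "((\<lambda>q. (f (fst q) - f (snd q)) / (fst q - snd q)) \<longlongrightarrow> (f a - f b) / (a - b)) ?F"
      using False by (intro tendsto_intros fst snd) auto
    moreover have "((\<lambda>q. fst q - snd q) \<longlongrightarrow> a - b) ?F"
      by (intro tendsto_intros fst snd)
    then have "eventually (\<lambda>q. fst q - snd q \<noteq> 0) ?F"
      using False by (intro tendsto_imp_eventually_ne) auto
    then have "eventually (\<lambda>q. (f (fst q) - f (snd q)) / (fst q - snd q) =
        divided_difference f f' (fst q) (snd q)) ?F"
      by eventually_elim (auto simp: divided_difference_def)
    ultimately show ?thesis
      using False by (auto simp: divided_difference_def[of f f' a b] intro: Lim_transform_eventually)
  next
    case True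
    show ?thesis
    proof (rule tendstoI)
      fix e :: real assume "0 < e"
      then obtain d where d: "0 < d" "\<And>z. 0 < z \<Longrightarrow> dist z a < d \<Longrightarrow> dist (f' z) (f' a) < e"
        using f' ab(2) unfolding continuous_on_iff by (metis greaterThan_iff)
      have "eventually (\<lambda>q. dist (fst q) a < d) ?F" "eventually (\<lambda>q. dist (snd q) a < d) ?F"
        using tendstoD[OF fst d(1)] tendstoD[OF snd d(1)] True by auto
      moreover have "eventually (\<lambda>q. q \<in> {0<..} \<times> {0<..}) ?F"
        by (simp add: eventually_at_filter)
      ultimately show "eventually (\<lambda>q. dist (divided_difference f f' (fst q) (snd q))
          (divided_difference f f' a b) < e) ?F"
      proof eventually_elim
        case (elim q)
        then have pos: "0 < fst q" "0 < snd q" by auto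
        obtain z where z: "min (fst q) (snd q) \<le> z" "z \<le> max (fst q) (snd q)"
          "divided_difference f f' (fst q) (snd q) = f' z"
          using divided_difference_mean_value[OF f pos] by blast
        have "0 < z" "dist z a < d"
          using z(1,2) pos elim(1,2) unfolding dist_real_def by linarith+
        then show ?case
          using d(2) z(3) True by (simp add: divided_difference_def)
      qed
    qed
  qed
  then show "((\<lambda>(x, y). divided_difference f f' x y) \<longlongrightarrow>
      (case p of (x, y) \<Rightarrow> divided_difference f f' x y)) ?F"
    by (simp add: ab case_prod_unfold)
qed

lemma mat_fun_id:
  assumes "hermitian A"
  shows "mat_fun (\<lambda>x. x) A = A"
proof -
  obtain K :: "real set" and P where sd: "spectral_decomposition A K (\<lambda>x. x) P"
    using hermitian_spectral_decomposition[OF assms] by blast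
  then have "A = (\<Sum>k\<in>K. k *\<^sub>R P k)"
    unfolding spectral_decomposition_def by blast
  then show ?thesis using mat_fun_eq[OF sd, of "\<lambda>x. x"] by (rule trans[OF _ sym, rotated])
qed

lemma mat_fun_diff:
  assumes "hermitian A"
  shows "mat_fun (\<lambda>x. f x - g x) A = mat_fun f A - mat_fun g A"
proof -
  obtain K :: "real set" and P where sd: "spectral_decomposition A K (\<lambda>x. x) P"
    using hermitian_spectral_decomposition[OF assms] by blast
  show ?thesis
    by (simp add: mat_fun_eq[OF sd] scaleR_diff_left sum_subtractf)
qed

lemma mat_fun_scale:
  assumes "hermitian A"
  shows "mat_fun (\<lambda>x. c * f x) A = c *\<^sub>R mat_fun f A"
proof -
  obtain K :: "real set" and P where sd: "spectral_decomposition A K (\<lambda>x. x) P"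
    using hermitian_spectral_decomposition[OF assms] by blast
  show ?thesis
    by (simp add: mat_fun_eq[OF sd] scaleR_sum_right)
qed

text \<open>An exact identity, not a first-order one. Multiplying by P k from the left turns B - A
  into B - \<lambda>_k, and (x - \<lambda>_k) times the divided difference at \<lambda>_k and x is
  f(x) - f(\<lambda>_k). Only the functional calculus of \<open>B\<close> occurs besides the fixed
  projections of \<open>A\<close>.\<close>

lemma mat_fun_diff_eq_divided_difference:
  assumes sd: "spectral_decomposition A K lam P" and B: "hermitian B"
  shows "mat_fun f B - mat_fun f A =
    (\<Sum>k\<in>K. P k ** (B - A) ** mat_fun (divided_difference f f' (lam k)) B)"
proof -
  have "P k ** (B - A) ** mat_fun (divided_difference f f' (lam k)) B =
      P k ** (mat_fun f B - mat_fun f A)" if k: "k \<in> K" for k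
  proof -
    let ?phi = "divided_difference f f' (lam k)"
    have "P k ** (B - A) ** mat_fun ?phi B =
        P k ** (mat_fun (\<lambda>x. x) B ** mat_fun ?phi B) - lam k *\<^sub>R (P k ** mat_fun ?phi B)"
      by (simp add: mat_fun_id[OF B] mmult.diff_left mmult.diff_right matrix_mul_assoc
          spectral_decomposition_mult[OF sd k] matrix_scaleR_left)
    also have "\<dots> = P k ** mat_fun (\<lambda>x. x * ?phi x - lam k * ?phi x) B"
      by (simp add: mat_fun_mult[OF B] mat_fun_diff[OF B] mat_fun_scale[OF B] mmult.diff_right
          matrix_scaleR_right)
    also have "(\<lambda>x. x * ?phi x - lam k * ?phi x) = (\<lambda>x. f x - f (lam k))"
      by (rule ext) (simp add: divided_difference_def field_simps)
    also have "P k ** mat_fun (\<lambda>x. f x - f (lam k)) B = P k ** (mat_fun f B - mat_fun f A)"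
      by (simp add: mat_fun_diff[OF B] mat_fun_const[OF B] mmult.diff_right matrix_scaleR_right
          spectral_proj_mat_fun[OF sd k])
    finally show ?thesis .
  qed
  then show ?thesis
    by (simp add: spectral_decomposition_sum[OF sd] flip: mmult.sum_left)
qed

text \<open>The projections are those of the base point and do not move, so the limit of the exact
  difference quotient needs only continuity of the divided differences as functions of
  \<open>B t\<close>.\<close>

theorem mat_fun_has_vector_derivative:
  fixes B :: "real \<Rightarrow> complex ^ 'n ^ 'n"
  assumes f: "\<And>x. 0 < x \<Longrightarrow> (f has_real_derivative f' x) (at x)" and f': "continuous_on {0<..} f'"
    and B: "\<And>t. positive_definite (B t)" and der: "(B has_vector_derivative H) (at a)"
  shows "((\<lambda>t. mat_fun f (B t)) has_vector_derivative
    mat_schur (divided_difference f f') (B a) H) (at a)"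
proof -
  let ?phi = "divided_difference f f'"
  obtain K :: "real set" and P where sd: "spectral_decomposition (B a) K (\<lambda>x. x) P"
    and pos: "\<And>x. x \<in> K \<Longrightarrow> 0 < x"
    using positive_definite_spectral[OF B] by blast
  have quot: "(mat_fun f (B t) - mat_fun f (B a)) /\<^sub>R (t - a) =
      (\<Sum>k\<in>K. P k ** ((B t - B a) /\<^sub>R (t - a)) ** mat_fun (?phi k) (B t))" for t
    unfolding mat_fun_diff_eq_divided_difference[OF sd positive_definite_hermitian[OF B], of f t f']
    by (simp add: scaleR_sum_right matrix_scaleR_left matrix_scaleR_right)
  have lim: "((\<lambda>t. (B t - B a) /\<^sub>R (t - a)) \<longlongrightarrow> H) (at a)"
    using der by (simp add: has_vector_derivative_iff_tendsto)
  have cont: "(B \<longlongrightarrow> B a) (at a)"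
    using has_vector_derivative_continuous[OF der] by (simp add: isCont_def)
  have phi: "((\<lambda>t. mat_fun (?phi k) (B t)) \<longlongrightarrow> mat_fun (?phi k) (B a)) (at a)" if "k \<in> K" for k
    unfolding mat_fun_def
  proof (rule mat_schur_tendsto[OF B _ B cont tendsto_const])
    have "continuous_on ({0<..} \<times> {0<..}) ((\<lambda>(x, y). ?phi x y) \<circ> (\<lambda>q :: real \<times> real. (k, fst q)))"
      using pos[OF that]
      by (intro continuous_on_compose continuous_intros
          continuous_on_subset[OF continuous_on_divided_difference[OF f f']]) auto
    then show "continuous_on ({0<..} \<times> {0<..}) (\<lambda>(x, y :: real). ?phi k x)"
      by (simp add: comp_def case_prod_unfold)
  qed
  have "((\<lambda>t. (mat_fun f (B t) - mat_fun f (B a)) /\<^sub>R (t - a)) \<longlongrightarrow>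
      (\<Sum>k\<in>K. P k ** H ** mat_fun (?phi k) (B a))) (at a)"
    unfolding quot by (intro tendsto_intros mmult.tendsto lim phi)
  also have "(\<Sum>k\<in>K. P k ** H ** mat_fun (?phi k) (B a)) = mat_schur ?phi (B a) H"
    by (simp add: mat_fun_eq[OF sd] mat_schur_eq[OF sd] mmult.sum_right matrix_scaleR_right)
  finally show ?thesis
    by (simp add: has_vector_derivative_iff_tendsto)
qed

section \<open>The sandwiched Renyi information matrix\<close>

lemma mat_schur_add:
  assumes "hermitian A"
  shows "mat_schur psi A H + mat_schur phi A H = mat_schur (\<lambda>x y. psi x y + phi x y) A H"
proof -
  obtain K :: "real set" and P where sd: "spectral_decomposition A K (\<lambda>x. x) P"
    using hermitian_spectral_decomposition[OF assms] by blast
  show ?thesis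
    by (simp add: mat_schur_eq[OF sd] scaleR_add_left sum.distrib)
qed

lemma mat_schur_scale:
  assumes "hermitian A"
  shows "c *\<^sub>R mat_schur psi A H = mat_schur (\<lambda>x y. c * psi x y) A H"
proof -
  obtain K :: "real set" and P where sd: "spectral_decomposition A K (\<lambda>x. x) P"
    using hermitian_spectral_decomposition[OF assms] by blast
  show ?thesis
    by (simp add: mat_schur_eq[OF sd] scaleR_sum_right)
qed

lemma mat_schur_mat_schur:
  assumes "hermitian A"
  shows "mat_schur psi A (mat_schur phi A H) = mat_schur (\<lambda>x y. psi x y * phi x y) A H"
proof -
  obtain K :: "real set" and P where sd: "spectral_decomposition A K (\<lambda>x. x) P"
    using hermitian_spectral_decomposition[OF assms] by blast
  show ?thesis
    by (rule spectral_block_eqI[OF sd]) (simp add: spectral_block_mat_schur[OF sd])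
qed

lemma mat_fun_mult_mat_schur:
  assumes "hermitian A"
  shows "mat_fun f A ** mat_schur psi A H = mat_schur (\<lambda>x y. f x * psi x y) A H"
proof -
  obtain K :: "real set" and P where sd: "spectral_decomposition A K (\<lambda>x. x) P"
    using hermitian_spectral_decomposition[OF assms] by blast
  show ?thesis
  proof (rule spectral_block_eqI[OF sd])
    fix k l assume kl: "k \<in> K" "l \<in> K"
    have "P k ** (mat_fun f A ** mat_schur psi A H) ** P l =
        (P k ** mat_fun f A) ** mat_schur psi A H ** P l"
      by (simp only: matrix_mul_assoc)
    then show "P k ** (mat_fun f A ** mat_schur psi A H) ** P l =
        P k ** mat_schur (\<lambda>x y. f x * psi x y) A H ** P l"
      using kl by (simp add: spectral_proj_mat_fun[OF sd] spectral_block_mat_schur[OF sd]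
          matrix_scaleR_left)
  qed
qed

lemma mat_schur_mult_mat_fun:
  assumes "hermitian A"
  shows "mat_schur psi A H ** mat_fun f A = mat_schur (\<lambda>x y. psi x y * f y) A H"
proof -
  obtain K :: "real set" and P where sd: "spectral_decomposition A K (\<lambda>x. x) P"
    using hermitian_spectral_decomposition[OF assms] by blast
  show ?thesis
  proof (rule spectral_block_eqI[OF sd])
    fix k l assume kl: "k \<in> K" "l \<in> K"
    have "P k ** (mat_schur psi A H ** mat_fun f A) ** P l =
        P k ** mat_schur psi A H ** (mat_fun f A ** P l)"
      by (simp only: matrix_mul_assoc)
    then show "P k ** (mat_schur psi A H ** mat_fun f A) ** P l =
        P k ** mat_schur (\<lambda>x y. psi x y * f y) A H ** P l"
      using kl by (simp add: mat_fun_spectral_proj[OF sd] spectral_block_mat_schur[OF sd]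
          matrix_scaleR_right mult.commute)
  qed
qed

text \<open>By idempotence and cyclicity the block of the first factor at (k, l) meets the block of
  the second at (l, k); hence the swapped arguments of \<open>phi\<close>.\<close>

lemma trace_mat_schur_mult_mat_schur:
  assumes sd: "spectral_decomposition A K lam P"
  shows "trace (mat_schur psi A X ** mat_schur phi A Y) =
    (\<Sum>k\<in>K. \<Sum>l\<in>K. (psi (lam k) (lam l) * phi (lam l) (lam k)) *\<^sub>R trace (P k ** X ** P l ** Y))"
proof -
  have *: "trace (P k ** X ** P l ** N) = trace (P k ** X ** (P l ** N ** P k))"
    if "k \<in> K" "l \<in> K" for k l N
  proof -
    have "trace (P k ** X ** P l ** N) = trace ((P k ** P k) ** X ** P l ** N)"
      using that by (simp add: spectral_decomposition_orthogonal[OF sd])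
    also have "\<dots> = trace (P k ** (P k ** X ** P l ** N))"
      by (simp only: matrix_mul_assoc)
    also have "\<dots> = trace ((P k ** X ** P l ** N) ** P k)"
      by (rule trace_mult_commute)
    finally show ?thesis by (simp only: matrix_mul_assoc)
  qed
  have block: "trace (P k ** X ** P l ** mat_schur phi A Y) =
      phi (lam l) (lam k) *\<^sub>R trace (P k ** X ** P l ** Y)"
    if kl: "k \<in> K" "l \<in> K" for k l
    by (simp only: *[OF kl, of "mat_schur phi A Y"] *[OF kl, of Y]
        spectral_block_mat_schur[OF sd kl(2,1)] matrix_scaleR_right trace_scaleR)
  have "trace (mat_schur psi A X ** mat_schur phi A Y) =
      (\<Sum>k\<in>K. \<Sum>l\<in>K. psi (lam k) (lam l) *\<^sub>R trace (P k ** X ** P l ** mat_schur phi A Y))"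
    unfolding mat_schur_eq[OF sd, of psi] mmult.sum_left trace_sum_matrix
    by (simp only: matrix_scaleR_left trace_scaleR)
  then show ?thesis
    by (simp add: block)
qed

section \<open>Powers of positive definite matrices\<close>

lemma mat_powr_0:
  assumes "positive_definite A"
  shows "mat_powr A 0 = mat 1"
proof -
  have "mat_powr A 0 = mat_fun (\<lambda>x. 1) A"
    unfolding mat_powr_eq_mat_fun[OF positive_definite_hermitian[OF assms]]
    by (rule mat_fun_cong_pos[OF assms]) simp
  then show ?thesis
    by (simp add: mat_fun_const positive_definite_hermitian assms)
qed

lemma mat_powr_1:
  assumes "positive_definite A"
  shows "mat_powr A 1 = A"
proof -
  have "mat_powr A 1 = mat_fun (\<lambda>x. x) A"
    unfolding mat_powr_eq_mat_fun[OF positive_definite_hermitian[OF assms]]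
    by (rule mat_fun_cong_pos[OF assms]) simp
  then show ?thesis
    by (simp add: mat_fun_id positive_definite_hermitian assms)
qed

lemma mat_powr_add:
  assumes "positive_definite A"
  shows "mat_powr A p ** mat_powr A r = mat_powr A (p + r)"
  using assms
  by (simp add: mat_powr_eq_mat_fun positive_definite_hermitian mat_fun_mult powr_add)

lemma spectral_decomposition_mat_powr:
  assumes sd: "spectral_decomposition A K lam P" and pos: "\<And>k. k \<in> K \<Longrightarrow> 0 < lam k" and p: "p \<noteq> 0"
  shows "spectral_decomposition (mat_powr A p) K (\<lambda>k. lam k powr p) P"
proof -
  have "inj_on (\<lambda>x. x powr p) (lam ` K)"
  proof (rule inj_onI)
    fix x y assume "x \<in> lam ` K" "y \<in> lam ` K" and eq: "x powr p = y powr p"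
    then have "0 < x" "0 < y" using pos by auto
    then show "x = y"
      using arg_cong[OF eq, of "\<lambda>z. z powr (1 / p)"] p by (simp add: powr_powr)
  qed
  from spectral_decomposition_mat_fun[OF sd this] show ?thesis
    by (simp add: mat_powr_eq_mat_fun spectral_decomposition_hermitian[OF sd])
qed

lemma mat_powr_mat_powr:
  assumes A: "positive_definite A" and p: "p \<noteq> 0"
  shows "mat_powr (mat_powr A p) r = mat_powr A (p * r)"
proof -
  obtain K :: "real set" and P where sd: "spectral_decomposition A K (\<lambda>x. x) P"
    and pos: "\<And>x. x \<in> K \<Longrightarrow> 0 < x"
    using positive_definite_spectral[OF A] by blast
  show ?thesis
    by (simp only: mat_powr_eq[OF spectral_decomposition_mat_powr[OF sd pos p], of r]
        mat_powr_eq[OF sd, of "p * r"] powr_powr)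
qed

text \<open>A nonzero power keeps eigenvalues distinct and has the same projections. This pulls
  double sums over R^(1/\<alpha>) back to double sums over \<open>R\<close>.\<close>

lemma mat_schur_mat_powr:
  assumes A: "positive_definite A" and p: "p \<noteq> 0"
  shows "mat_schur psi (mat_powr A p) H = mat_schur (\<lambda>x y. psi (x powr p) (y powr p)) A H"
proof -
  obtain K :: "real set" and P where sd: "spectral_decomposition A K (\<lambda>x. x) P"
    and pos: "\<And>x. x \<in> K \<Longrightarrow> 0 < x"
    using positive_definite_spectral[OF A] by blast
  show ?thesis
    by (simp add: mat_schur_eq[OF sd] mat_schur_eq[OF spectral_decomposition_mat_powr[OF sd pos p]])
qed

lemma positive_definite_sandwich:
  assumes A: "positive_definite A" and R: "positive_definite R"
  shows "positive_definite (mat_powr A s ** R ** mat_powr A s)"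
proof (rule positive_definite_conjugate[OF R])
  show "hermitian (mat_powr A s)"
    using A by (simp add: mat_powr_eq_mat_fun positive_definite_hermitian hermitian_mat_fun)
  show "mat_powr A (- s) ** mat_powr A s = mat 1"
    by (simp add: mat_powr_add[OF A] mat_powr_0[OF A])
qed

definition powr_dd :: "real \<Rightarrow> real \<Rightarrow> real \<Rightarrow> real" where
  "powr_dd p = divided_difference (\<lambda>x. x powr p) (\<lambda>x. p * x powr (p - 1))"

lemma powr_dd_commute: "powr_dd p x y = powr_dd p y x"
  unfolding powr_dd_def by (rule divided_difference_commute)

lemma powr_dd_same: "powr_dd p x x = p * x powr (p - 1)"
  by (simp add: powr_dd_def divided_difference_def)

lemma powr_dd_distinct: "x \<noteq> y \<Longrightarrow> powr_dd p x y = (x powr p - y powr p) / (x - y)"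
  by (simp add: powr_dd_def divided_difference_def)

lemma continuous_on_powr_deriv: "continuous_on {0<..} (\<lambda>x :: real. p * x powr (p - 1))"
  by (intro continuous_intros) auto

lemma continuous_on_powr_dd: "continuous_on ({0<..} \<times> {0<..}) (\<lambda>(x, y). powr_dd p x y)"
  unfolding powr_dd_def
  by (intro continuous_on_divided_difference has_real_derivative_powr continuous_on_powr_deriv)

lemma mat_powr_has_vector_derivative:
  assumes "\<And>t. positive_definite (B t)" "(B has_vector_derivative H) (at a)"
  shows "((\<lambda>t. mat_powr (B t) p) has_vector_derivative mat_schur (powr_dd p) (B a) H) (at a)"
  using mat_fun_has_vector_derivative[OF has_real_derivative_powr continuous_on_powr_deriv assms, of p]
  by (simp add: powr_dd_def mat_powr_eq_mat_fun positive_definite_hermitian assms(1))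

text \<open>On the diagonal the divided difference is p x^(p - 1). The case r = 0 is the derivative
  of the trace of a power; r = 1 - p leaves p Tr H, which vanishes along states.\<close>

lemma trace_mat_powr_mult_schur:
  assumes A: "positive_definite A"
  shows "trace (mat_powr A r ** mat_schur (powr_dd p) A H) = p *\<^sub>R trace (mat_powr A (r + p - 1) ** H)"
proof -
  have h: "hermitian A" by (rule positive_definite_hermitian[OF A])
  have "mat_fun (\<lambda>x. x powr r * powr_dd p x x) A = mat_fun (\<lambda>x. p * x powr (r + p - 1)) A"
    by (rule mat_fun_cong_pos[OF A]) (simp add: powr_dd_same add_diff_eq flip: powr_add)
  then show ?thesis
    by (simp add: mat_powr_eq_mat_fun[OF h] trace_mat_fun_mult_mat_schur[OF h] mat_fun_scale[OF h]
        matrix_scaleR_left trace_scaleR)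
qed

text \<open>
  The summand \<open>2 *\<^sub>R mat_powr A (1 - s)\<close> does not change the gradient of the trace functional along
  states, since \<open>trace (mat_powr A (1 - s) ** d (mat_powr A s)) = s * trace (d A) = 0\<close>. It makes the
  factor vanish at \<open>A = R\<close>, so that no second derivative of a matrix power is ever needed.
\<close>

definition sandwich_factor ::
    "real \<Rightarrow> real \<Rightarrow> complex ^ 'n ^ 'n \<Rightarrow> complex ^ 'n ^ 'n \<Rightarrow> complex ^ 'n ^ 'n" where
  "sandwich_factor \<alpha> s R A =
     (let S = mat_powr A s; E = mat_powr (S ** R ** S) (\<alpha> - 1)
      in R ** S ** E + E ** S ** R - 2 *\<^sub>R mat_powr A (1 - s))"

text \<open>The product rule for S R S gives two terms, and cyclicity moves the derivative of S to
  the right end of both. The correction in \<open>sandwich_factor\<close> contributes s Tr H =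
  0.\<close>

lemma sandwich_trace_has_vector_derivative:
  fixes A :: "real \<Rightarrow> complex ^ 'n ^ 'n"
  assumes R: "positive_definite R" and A: "\<And>t. positive_definite (A t)"
    and der: "(A has_vector_derivative H) (at a)" and tr: "trace H = 0"
  shows "((\<lambda>t. trace (mat_powr (mat_powr (A t) s ** R ** mat_powr (A t) s) \<alpha>)) has_vector_derivative
    \<alpha> *\<^sub>R trace (sandwich_factor \<alpha> s R (A a) ** mat_schur (powr_dd s) (A a) H)) (at a)"
proof -
  let ?S = "\<lambda>t. mat_powr (A t) s"
  let ?L = "\<lambda>t. ?S t ** R ** ?S t"
  let ?Y = "mat_schur (powr_dd s) (A a) H"
  let ?E = "mat_powr (?L a) (\<alpha> - 1)"
  have S: "(?S has_vector_derivative ?Y) (at a)"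
    by (rule mat_powr_has_vector_derivative[OF A der])
  have "((\<lambda>t. ?S t ** (R ** ?S t)) has_vector_derivative ?S a ** (R ** ?Y) + ?Y ** (R ** ?S a)) (at a)"
    by (intro mmult.has_vector_derivative S
        bounded_linear.has_vector_derivative[OF mmult.bounded_linear_right])
  then have L: "(?L has_vector_derivative ?S a ** R ** ?Y + ?Y ** R ** ?S a) (at a)"
    by (simp add: matrix_mul_assoc)
  have Lpos: "positive_definite (?L t)" for t
    by (rule positive_definite_sandwich[OF A R])
  have trE: "trace (mat_schur (powr_dd \<alpha>) (?L a) X) = \<alpha> *\<^sub>R trace (?E ** X)" for X
    using trace_mat_powr_mult_schur[OF Lpos[of a], of 0 \<alpha> X] by (simp add: mat_powr_0[OF Lpos])
  have "((\<lambda>t. trace (mat_powr (?L t) \<alpha>)) has_vector_derivative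
      trace (mat_schur (powr_dd \<alpha>) (?L a) (?S a ** R ** ?Y + ?Y ** R ** ?S a))) (at a)"
    by (intro bounded_linear.has_vector_derivative[OF bounded_linear_trace]
        mat_powr_has_vector_derivative Lpos L)
  moreover have "trace (?E ** (?S a ** R ** ?Y + ?Y ** R ** ?S a)) =
      trace (sandwich_factor \<alpha> s R (A a) ** ?Y)"
  proof -
    have "trace (?E ** (?Y ** R ** ?S a)) = trace ((?E ** ?Y) ** (R ** ?S a))"
      by (simp only: matrix_mul_assoc)
    also have "\<dots> = trace ((R ** ?S a) ** (?E ** ?Y))"
      by (rule trace_mult_commute)
    finally have 1: "trace (?E ** (?Y ** R ** ?S a)) = trace (R ** ?S a ** ?E ** ?Y)"
      by (simp only: matrix_mul_assoc)
    have 2: "trace (mat_powr (A a) (1 - s) ** ?Y) = 0"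
      by (simp add: trace_mat_powr_mult_schur[OF A] mat_powr_0[OF A] tr)
    have "trace (sandwich_factor \<alpha> s R (A a) ** ?Y) =
        trace (R ** ?S a ** ?E ** ?Y) + trace (?E ** ?S a ** R ** ?Y)"
      using 2 by (simp add: sandwich_factor_def Let_def mmult.add_left mmult.diff_left
          matrix_scaleR_left trace_add trace_sub trace_scaleR)
    moreover have "trace (?E ** (?S a ** R ** ?Y + ?Y ** R ** ?S a)) =
        trace (?E ** ?S a ** R ** ?Y) + trace (?E ** (?Y ** R ** ?S a))"
      by (simp add: mmult.add_right trace_add matrix_mul_assoc)
    ultimately show ?thesis using 1 by simp
  qed
  ultimately show ?thesis
    unfolding trE by simp
qed

lemma sandwich_trace_pos:
  assumes "positive_definite A" "positive_definite R"
  shows "0 < Re (trace (mat_powr (mat_powr A s ** R ** mat_powr A s) \<alpha>))"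
  using positive_definite_sandwich[OF assms, of s]
  by (simp add: mat_powr_eq_mat_fun positive_definite_hermitian trace_mat_fun_pos)

lemma sandwiched_renyi_has_vector_derivative:
  fixes A :: "real \<Rightarrow> complex ^ 'n ^ 'n"
  assumes R: "positive_definite R" and A: "\<And>t. positive_definite (A t)"
    and der: "(A has_vector_derivative H) (at a)" and tr: "trace H = 0"
    and s: "s = (1 - \<alpha>) / (2 * \<alpha>)"
  shows "((\<lambda>t. sandwiched_renyi \<alpha> R (A t)) has_vector_derivative
    \<alpha> / (\<alpha> - 1) * Re (trace (sandwich_factor \<alpha> s R (A a) ** mat_schur (powr_dd s) (A a) H)) /
      Re (trace (mat_powr (mat_powr (A a) s ** R ** mat_powr (A a) s) \<alpha>))) (at a)"
proof -
  let ?q = "\<lambda>t. Re (trace (mat_powr (mat_powr (A t) s ** R ** mat_powr (A t) s) \<alpha>))"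
  let ?D = "\<alpha> * Re (trace (sandwich_factor \<alpha> s R (A a) ** mat_schur (powr_dd s) (A a) H))"
  have "(?q has_real_derivative ?D) (at a)"
    using has_field_derivative_Re[OF sandwich_trace_has_vector_derivative[OF R A der tr, of s \<alpha>]]
    by simp
  then have "((\<lambda>t. 1 / (\<alpha> - 1) * ln (?q t)) has_real_derivative 1 / (\<alpha> - 1) * (1 / ?q a * ?D)) (at a)"
    by (intro DERIV_cmult DERIV_chain2[OF DERIV_ln_divide] sandwich_trace_pos A R)
  then show ?thesis
    unfolding sandwiched_renyi_def s[symmetric] has_real_derivative_iff_has_vector_derivative
    by (simp add: field_simps)
qed

text \<open>The symbol of the derivative of \<open>sandwich_factor\<close> at A = R. The three
  summands come from differentiating S, E and the correction. The square has one factor from the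
  derivative of S R S and one from multiplying the derivative of E by R S and by S R; the arguments
  x^(1/\<alpha>), y^(1/\<alpha>) are eigenvalues of S R S.\<close>

definition sandwich_symbol :: "real \<Rightarrow> real \<Rightarrow> real \<Rightarrow> real \<Rightarrow> real" where
  "sandwich_symbol \<alpha> s x y =
     powr_dd s x y * (x * y powr (- 2 * s) + x powr (- 2 * s) * y) +
     powr_dd (\<alpha> - 1) (x powr (1 / \<alpha>)) (y powr (1 / \<alpha>)) * powr_dd s x y *
       (x powr (1 + s) + y powr (1 + s))\<^sup>2 -
     2 * powr_dd (1 - s) x y"

lemma
  assumes R: "positive_definite R" and \<alpha>: "0 < \<alpha>" and s: "s = (1 - \<alpha>) / (2 * \<alpha>)"
  shows sandwich_self: "mat_powr R s ** R ** mat_powr R s = mat_powr R (1 / \<alpha>)"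
    and sandwich_self_powr: "mat_powr (mat_powr R s ** R ** mat_powr R s) (\<alpha> - 1) = mat_powr R (- 2 * s)"
    and sandwich_factor_self: "sandwich_factor \<alpha> s R R = 0"
proof -
  have e: "s + 1 + s = 1 / \<alpha>" "1 / \<alpha> * (\<alpha> - 1) = - 2 * s"
    using \<alpha> by (simp_all add: s field_simps)
  have "mat_powr R s ** mat_powr R 1 ** mat_powr R s = mat_powr R (s + 1 + s)"
    by (simp only: mat_powr_add[OF R])
  then show L: "mat_powr R s ** R ** mat_powr R s = mat_powr R (1 / \<alpha>)"
    by (simp only: e mat_powr_1[OF R])
  show E: "mat_powr (mat_powr R s ** R ** mat_powr R s) (\<alpha> - 1) = mat_powr R (- 2 * s)"
    using mat_powr_mat_powr[OF R, of "1 / \<alpha>" "\<alpha> - 1"] \<alpha> unfolding L e(2) by simp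
  have "mat_powr R 1 ** mat_powr R s ** mat_powr R (- 2 * s) = mat_powr R (1 - s)"
    "mat_powr R (- 2 * s) ** mat_powr R s ** mat_powr R 1 = mat_powr R (1 - s)"
    unfolding mat_powr_add[OF R] by (rule arg_cong[where f = "mat_powr R"], simp)+
  then show "sandwich_factor \<alpha> s R R = 0"
    unfolding sandwich_factor_def Let_def E mat_powr_1[OF R] by (simp flip: scaleR_2)
qed

text \<open>At the base point all undifferentiated factors are powers of \<open>R\<close>.
  Multiplying by them on the left or right only multiplies the symbol by a function of x or of y, so
  the product rule collapses to one double sum.\<close>

lemma sandwich_factor_has_vector_derivative:
  fixes A :: "real \<Rightarrow> complex ^ 'n ^ 'n"
  assumes A: "\<And>t. positive_definite (A t)" and der: "(A has_vector_derivative H) (at a)"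
    and \<alpha>: "0 < \<alpha>" and s: "s = (1 - \<alpha>) / (2 * \<alpha>)"
  shows "((\<lambda>t. sandwich_factor \<alpha> s (A a) (A t)) has_vector_derivative
    mat_schur (sandwich_symbol \<alpha> s) (A a) H) (at a)"
proof -
  let ?R = "A a"
  let ?S = "\<lambda>t. mat_powr (A t) s"
  let ?L = "\<lambda>t. ?S t ** ?R ** ?S t"
  let ?E = "\<lambda>t. mat_powr (?L t) (\<alpha> - 1)"
  let ?S' = "mat_schur (powr_dd s) ?R H"
  let ?L' = "?S a ** ?R ** ?S' + ?S' ** ?R ** ?S a"
  let ?E' = "mat_schur (powr_dd (\<alpha> - 1)) (?L a) ?L'"
  have R: "positive_definite ?R" by (rule A)
  have h: "hermitian ?R" by (rule positive_definite_hermitian[OF R])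
  have S: "(?S has_vector_derivative ?S') (at a)"
    by (rule mat_powr_has_vector_derivative[OF A der])
  have left: "((\<lambda>t. ?R ** ?S t) has_vector_derivative ?R ** ?S') (at a)"
    by (rule bounded_linear.has_vector_derivative[OF mmult.bounded_linear_right S])
  have right: "((\<lambda>t. ?S t ** ?R) has_vector_derivative ?S' ** ?R) (at a)"
    by (rule bounded_linear.has_vector_derivative[OF mmult.bounded_linear_left S])
  have L: "(?L has_vector_derivative ?L') (at a)"
    using mmult.has_vector_derivative[OF right S] by simp
  have E: "(?E has_vector_derivative ?E') (at a)"
    by (rule mat_powr_has_vector_derivative[OF positive_definite_sandwich[OF A R] L])
  have "((\<lambda>t. ?R ** ?S t ** ?E t + ?E t ** (?S t ** ?R) - 2 *\<^sub>R mat_powr (A t) (1 - s))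
      has_vector_derivative
        (?R ** ?S a ** ?E' + ?R ** ?S' ** ?E a) + (?E a ** (?S' ** ?R) + ?E' ** (?S a ** ?R)) -
        2 *\<^sub>R mat_schur (powr_dd (1 - s)) ?R H) (at a)"
    by (intro has_vector_derivative_diff has_vector_derivative_add
        mmult.has_vector_derivative[OF left E] mmult.has_vector_derivative[OF E right]
        bounded_linear.has_vector_derivative[OF bounded_linear_scaleR_right]
        mat_powr_has_vector_derivative[OF A der])
  then have der': "((\<lambda>t. sandwich_factor \<alpha> s ?R (A t)) has_vector_derivative
        (?R ** ?S a ** ?E' + ?R ** ?S' ** ?E a) + (?E a ** (?S' ** ?R) + ?E' ** (?S a ** ?R)) -
        2 *\<^sub>R mat_schur (powr_dd (1 - s)) ?R H) (at a)"
    by (simp add: sandwich_factor_def Let_def matrix_mul_assoc)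
  have RS: "?R ** ?S a = mat_powr ?R (1 + s)" "?S a ** ?R = mat_powr ?R (1 + s)"
    using mat_powr_add[OF R, of 1 s] mat_powr_add[OF R, of s 1]
    by (simp_all add: mat_powr_1[OF R] add.commute)
  have left_schur: "mat_powr ?R p ** mat_schur psi ?R X = mat_schur (\<lambda>x y. x powr p * psi x y) ?R X"
    and right_schur: "mat_schur psi ?R X ** mat_powr ?R p = mat_schur (\<lambda>x y. psi x y * y powr p) ?R X"
    for p psi X
    by (simp_all add: mat_powr_eq_mat_fun[OF h] mat_fun_mult_mat_schur[OF h] mat_schur_mult_mat_fun[OF h])
  have R_schur: "?R ** mat_schur psi ?R X = mat_schur (\<lambda>x y. x * psi x y) ?R X"
    and schur_R: "mat_schur psi ?R X ** ?R = mat_schur (\<lambda>x y. psi x y * y) ?R X" for psi X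
    using mat_fun_mult_mat_schur[OF h, of "\<lambda>x. x" psi X] mat_schur_mult_mat_fun[OF h, of psi X "\<lambda>x. x"]
    by (simp_all add: mat_fun_id[OF h])
  have L': "?L' = mat_schur (\<lambda>x y. x powr (1 + s) * powr_dd s x y + powr_dd s x y * y powr (1 + s)) ?R H"
  proof -
    have "?S' ** ?R ** ?S a = ?S' ** (?R ** ?S a)" by (simp only: matrix_mul_assoc)
    then show ?thesis
      by (simp only: RS left_schur right_schur mat_schur_add[OF h])
  qed
  have E': "?E' = mat_schur (\<lambda>x y. powr_dd (\<alpha> - 1) (x powr (1 / \<alpha>)) (y powr (1 / \<alpha>)) *
      (x powr (1 + s) * powr_dd s x y + powr_dd s x y * y powr (1 + s))) ?R H"
    using \<alpha> unfolding L' sandwich_self[OF R \<alpha> s]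
    by (simp add: mat_schur_mat_powr[OF R] mat_schur_mat_schur[OF h])
  have "(?R ** ?S a ** ?E' + ?R ** ?S' ** ?E a) + (?E a ** (?S' ** ?R) + ?E' ** (?S a ** ?R)) -
      2 *\<^sub>R mat_schur (powr_dd (1 - s)) ?R H =
      (?R ** ?S a ** ?E' + ?R ** ?S' ** ?E a) + (?E a ** (?S' ** ?R) + ?E' ** (?S a ** ?R)) +
      (- 2) *\<^sub>R mat_schur (powr_dd (1 - s)) ?R H"
    by simp
  also have "\<dots> = mat_schur (sandwich_symbol \<alpha> s) ?R H"
    unfolding E' sandwich_self_powr[OF R \<alpha> s]
    unfolding RS left_schur right_schur R_schur schur_R
      mat_schur_add[OF h] mat_schur_scale[OF h]
    by (rule arg_cong[where f = "\<lambda>psi. mat_schur psi ?R H"], intro ext)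
      (simp add: sandwich_symbol_def power2_eq_square algebra_simps)
  finally show ?thesis using der' by simp
qed

text \<open>With u = x^s and v = y^s the left-hand side is \<open>sandwich_symbol\<close> times the
  divided difference of the power s. Multiplication by d^2 e u^2 v^2 leaves a polynomial identity;
  naming the denominators d and e keeps them atomic while fractions are cleared.\<close>

lemma sandwich_rational_identity:
  fixes x y u v :: real
  assumes "x \<noteq> y" "u \<noteq> 0" "v \<noteq> 0" "x * u\<^sup>2 - y * v\<^sup>2 \<noteq> 0"
  shows "(u - v) / (x - y) * ((u - v) / (x - y) * (x / v\<^sup>2 + y / u\<^sup>2) +
      (1 / u\<^sup>2 - 1 / v\<^sup>2) / (x * u\<^sup>2 - y * v\<^sup>2) * ((u - v) / (x - y)) * (x * u + y * v)\<^sup>2 -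
      2 * ((x / u - y / v) / (x - y))) = - ((u\<^sup>2 - v\<^sup>2) / (x * u\<^sup>2 - y * v\<^sup>2))"
proof -
  define d e where "d = x - y" and "e = x * u\<^sup>2 - y * v\<^sup>2"
  have nz: "d \<noteq> 0" "e \<noteq> 0" using assms by (simp_all add: d_def e_def)
  have "(u - v) * ((u - v) * (x * u\<^sup>2 + y * v\<^sup>2) * e - (u\<^sup>2 - v\<^sup>2) * (u - v) * (x * u + y * v)\<^sup>2 -
      2 * (x * v - y * u) * u * v * e) = - ((u\<^sup>2 - v\<^sup>2) * d\<^sup>2 * u\<^sup>2 * v\<^sup>2)"
    unfolding d_def e_def by algebra
  then show ?thesis
    using assms(2,3) nz unfolding d_def[symmetric] e_def[symmetric]
    by (simp add: divide_simps power2_eq_square) algebra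
qed

lemma sandwich_symbol_eq_zeta:
  assumes \<alpha>: "0 < \<alpha>" "\<alpha> \<noteq> 1" and s: "s = (1 - \<alpha>) / (2 * \<alpha>)" and xy: "0 < x" "0 < y"
  shows "1 / (\<alpha> - 1) * (sandwich_symbol \<alpha> s x y * powr_dd s y x) = sandwiched_zeta \<alpha> x y"
proof -
  define u v where "u = x powr s" and "v = y powr s"
  have uv: "0 < u" "0 < v" using xy by (simp_all add: u_def v_def)
  have e: "1 / \<alpha> = 1 + s + s" "(1 - \<alpha>) / \<alpha> = s + s" "- 2 * s = - (s + s)" "1 / \<alpha> * (\<alpha> - 1) = - (s + s)"
    using \<alpha> by (simp_all add: s field_simps)
  have pw: "z powr (1 / \<alpha>) = z * (z powr s)\<^sup>2" "z powr ((1 - \<alpha>) / \<alpha>) = (z powr s)\<^sup>2"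
    "z powr (- 2 * s) = 1 / (z powr s)\<^sup>2" "z powr (1 + s) = z * z powr s"
    "z powr (1 - s) = z / z powr s" "(z powr (1 / \<alpha>)) powr (\<alpha> - 1) = 1 / (z powr s)\<^sup>2"
    if "0 < z" for z
  proof -
    show "z powr (1 / \<alpha>) = z * (z powr s)\<^sup>2"
      unfolding e(1) using that by (simp only: powr_add) (simp add: power2_eq_square)
    show "z powr ((1 - \<alpha>) / \<alpha>) = (z powr s)\<^sup>2"
      unfolding e(2) by (simp only: powr_add power2_eq_square)
    show 3: "z powr (- 2 * s) = 1 / (z powr s)\<^sup>2"
      unfolding e(3) by (simp only: powr_minus_divide powr_add power2_eq_square)
    show "z powr (1 + s) = z * z powr s" using that by (simp add: powr_add)
    show "z powr (1 - s) = z / z powr s" using that by (simp add: powr_diff)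
    show "(z powr (1 / \<alpha>)) powr (\<alpha> - 1) = 1 / (z powr s)\<^sup>2"
      unfolding powr_powr e(4) 3[symmetric] e(3) ..
  qed
  show ?thesis
  proof (cases "x = y")
    case False
    have "x powr (1 / \<alpha>) \<noteq> y powr (1 / \<alpha>)"
      using False xy \<alpha>(1) powr_less_mono2[of "1 / \<alpha>" x y] powr_less_mono2[of "1 / \<alpha>" y x]
      by (cases "x < y") auto
    then have ne: "x * u\<^sup>2 \<noteq> y * v\<^sup>2"
      using xy by (simp add: pw u_def v_def)
    have dd: "powr_dd (\<alpha> - 1) (x powr (1 / \<alpha>)) (y powr (1 / \<alpha>)) =
        (1 / u\<^sup>2 - 1 / v\<^sup>2) / (x * u\<^sup>2 - y * v\<^sup>2)"
      unfolding powr_dd_distinct[OF \<open>x powr (1 / \<alpha>) \<noteq> y powr (1 / \<alpha>)\<close>]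
        pw(6)[OF xy(1)] pw(6)[OF xy(2)] u_def[symmetric] v_def[symmetric]
      unfolding pw(1)[OF xy(1)] pw(1)[OF xy(2)] u_def[symmetric] v_def[symmetric] ..
    have "sandwich_symbol \<alpha> s x y * powr_dd s y x = - ((u\<^sup>2 - v\<^sup>2) / (x * u\<^sup>2 - y * v\<^sup>2))"
      using sandwich_rational_identity[of x y u v] False ne uv
      unfolding sandwich_symbol_def dd
      unfolding powr_dd_commute[of s y x] powr_dd_distinct[OF False] pw[OF xy(1)] pw[OF xy(2)]
        u_def[symmetric] v_def[symmetric]
      by (simp add: mult.commute)
    moreover have "sandwiched_zeta \<alpha> x y = 1 / (1 - \<alpha>) * ((u\<^sup>2 - v\<^sup>2) / (x * u\<^sup>2 - y * v\<^sup>2))"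
      using False unfolding sandwiched_zeta_def pw[OF xy(1)] pw[OF xy(2)] u_def[symmetric] v_def[symmetric]
      by simp
    moreover have "1 / (1 - \<alpha>) = - (1 / (\<alpha> - 1))"
      using minus_divide_right[of 1 "\<alpha> - 1"] by simp
    ultimately show ?thesis by (simp only: mult_minus_left mult_minus_right)
  next
    case True
    have d1: "powr_dd s x x = s * u / x"
      using xy by (simp add: powr_dd_same powr_diff u_def)
    have d2: "powr_dd (1 - s) x x = (1 - s) / u"
      using xy by (simp add: powr_dd_same powr_minus_divide u_def)
    have d3: "powr_dd (\<alpha> - 1) (x powr (1 / \<alpha>)) (x powr (1 / \<alpha>)) = (\<alpha> - 1) / (x * u ^ 4)"
    proof -
      have "(x powr (1 / \<alpha>)) powr (\<alpha> - 1 - 1) = 1 / u\<^sup>2 / (x * u\<^sup>2)"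
        unfolding powr_diff[of _ "\<alpha> - 1" 1] pw(6)[OF xy(1)] u_def[symmetric]
        using xy by (simp add: pw(1) u_def)
      then show ?thesis
        by (simp add: powr_dd_same power2_eq_square power_numeral_reduce mult_ac)
    qed
    \<comment> \<open>The summands are 2s/u, 4s(\<alpha> - 1)/u and -2(1 - s)/u. Since s \<alpha> =
      (1 - \<alpha>)/2, they add up to -2 \<alpha>/u.\<close>
    have "sandwich_symbol \<alpha> s x x = (4 * (s * \<alpha>) - 2) / u"
      unfolding sandwich_symbol_def d1 d2 d3
      unfolding pw[OF xy(1)] u_def[symmetric]
      using xy uv by (simp add: field_simps power2_eq_square power_numeral_reduce)
    also have "4 * (s * \<alpha>) - 2 = - 2 * \<alpha>" using \<alpha> by (simp add: s field_simps)
    finally have "sandwich_symbol \<alpha> s x x = - 2 * \<alpha> / u" .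
    then have "sandwich_symbol \<alpha> s x x * powr_dd s x x = - 2 * (s * \<alpha>) / x"
      using uv by (simp add: d1)
    also have "s * \<alpha> = (1 - \<alpha>) / 2" using \<alpha> by (simp add: s)
    finally show ?thesis
      using True \<alpha>(2) xy by (simp add: sandwiched_zeta_def divide_simps)
  qed
qed

section \<open>Partial derivatives and the information matrix\<close>

lemma has_vector_derivative_line:
  assumes "(f has_derivative f') (at x)"
  shows "((\<lambda>t. f (x + t *\<^sub>R v)) has_vector_derivative f' v) (at 0)"
proof -
  have "((\<lambda>t. f (x + t *\<^sub>R v)) has_derivative (\<lambda>t. f' (t *\<^sub>R v))) (at 0)"
    using assms by (intro has_derivative_compose[where f = "\<lambda>t. x + t *\<^sub>R v" and g = f])
      (auto intro!: derivative_eq_intros)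
  then show ?thesis
    by (simp add: has_vector_derivative_def linear_scale[OF has_derivative_linear[OF assms]])
qed

lemma partial_eq:
  assumes "(f has_derivative f') (at x)"
  shows "partial i f x = f' (axis i 1)"
  unfolding partial_def by (rule vector_derivative_at[OF has_vector_derivative_line[OF assms]])

theorem corollary21:
  fixes \<rho> :: "real ^ 'L \<Rightarrow> complex ^ 'n ^ 'n"
    and \<alpha> :: real
    and \<theta> :: "real ^ 'L"
    and i j :: 'L
    and K :: "'k set" and lam :: "'k \<Rightarrow> real" and P :: "'k \<Rightarrow> complex ^ 'n ^ 'n"
  assumes "twice_differentiable \<rho>"
    and "\<And>\<theta>'. quantum_state (\<rho> \<theta>')"
    and "\<And>\<theta>'. positive_definite (\<rho> \<theta>')"
    and "\<alpha> \<in> {0<..<1} \<union> {1<..}"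
    and "spectral_decomposition (\<rho> \<theta>) K lam P"
  shows "complex_of_real (sandwiched_renyi_info \<alpha> \<rho> \<theta> $ i $ j) =
    (\<Sum>k\<in>K. \<Sum>l\<in>K. complex_of_real (sandwiched_zeta \<alpha> (lam k) (lam l)) *
       trace (P k ** partial i \<rho> \<theta> ** P l ** partial j \<rho> \<theta>))"
proof -
  note pos = assms(3) and sd = assms(5)
  have \<alpha>: "0 < \<alpha>" "\<alpha> \<noteq> 1" using assms(4) by auto
  define s where "s = (1 - \<alpha>) / (2 * \<alpha>)"
  obtain \<rho>' where der: "\<And>x. (\<rho> has_derivative blinfun_apply (\<rho>' x)) (at x)"
    and cont': "\<And>x. isCont \<rho>' x"
    using assms(1) differentiable_imp_continuous_within unfolding twice_differentiable_def by blast
  define d\<rho> where "d\<rho> k x = blinfun_apply (\<rho>' x) (axis k 1)" for k x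
  have partial: "partial k \<rho> x = d\<rho> k x" for k x
    unfolding d\<rho>_def by (rule partial_eq[OF der])
  have curve: "((\<lambda>t. \<rho> (x + t *\<^sub>R axis k 1)) has_vector_derivative d\<rho> k x) (at 0)" for k x
    unfolding d\<rho>_def by (rule has_vector_derivative_line[OF der])
  have tr: "trace (d\<rho> k x) = 0" for k x
  proof (rule vector_derivative_unique_at)
    show "((\<lambda>t. trace (\<rho> (x + t *\<^sub>R axis k 1))) has_vector_derivative trace (d\<rho> k x)) (at 0)"
      by (rule bounded_linear.has_vector_derivative[OF bounded_linear_trace curve])
    show "((\<lambda>t. trace (\<rho> (x + t *\<^sub>R axis k 1))) has_vector_derivative 0) (at 0)"
      using assms(2) by (simp add: quantum_state_def)
  qed
  have herm: "cadjoint (d\<rho> k x) = d\<rho> k x" for k x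
  proof (rule vector_derivative_unique_at)
    have "cadjoint (\<rho> y) = \<rho> y" for y
      using positive_definite_hermitian[OF pos] by (simp add: hermitian_def)
    then show "((\<lambda>t. \<rho> (x + t *\<^sub>R axis k 1)) has_vector_derivative cadjoint (d\<rho> k x)) (at 0)"
      using bounded_linear.has_vector_derivative[OF bounded_linear_cadjoint curve, of x k] by simp
  qed (rule curve)
  let ?R = "\<rho> \<theta>"
  let ?Z = "\<lambda>A. sandwich_factor \<alpha> s ?R A"
  let ?q = "\<lambda>A. Re (trace (mat_powr (mat_powr A s ** ?R ** mat_powr A s) \<alpha>))"
  let ?Y = "\<lambda>\<epsilon>. mat_schur (powr_dd s) (\<rho> (\<theta> + \<epsilon>)) (d\<rho> j (\<theta> + \<epsilon>))"
  \<comment> \<open>Established at every \<epsilon>, since this function of \<epsilon> is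
    differentiated once more.\<close>
  have grad: "partial j (\<lambda>\<epsilon>. sandwiched_renyi \<alpha> ?R (\<rho> (\<theta> + \<epsilon>))) \<epsilon> =
      \<alpha> / (\<alpha> - 1) * Re (trace (?Z (\<rho> (\<theta> + \<epsilon>)) ** ?Y \<epsilon>)) / ?q (\<rho> (\<theta> + \<epsilon>))" for \<epsilon>
    using vector_derivative_at[OF sandwiched_renyi_has_vector_derivative[OF pos[of \<theta>] pos
          curve[of "\<theta> + \<epsilon>" j] tr s_def]]
    by (simp add: partial_def add.assoc)
  define A where "A t = \<rho> (\<theta> + t *\<^sub>R axis i 1)" for t
  have A0: "A 0 = ?R" by (simp add: A_def)
  have Apos: "positive_definite (A t)" for t unfolding A_def by (rule pos)
  have A': "(A has_vector_derivative d\<rho> i \<theta>) (at 0)" unfolding A_def by (rule curve)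
  let ?W = "mat_schur (sandwich_symbol \<alpha> s) ?R (d\<rho> i \<theta>)"
  have Z': "((\<lambda>t. ?Z (A t)) has_vector_derivative ?W) (at 0)"
    using sandwich_factor_has_vector_derivative[OF Apos A' \<alpha>(1) s_def] by (simp add: A0)
  have Z0: "?Z (A 0) = 0" unfolding A0 by (rule sandwich_factor_self[OF pos \<alpha>(1) s_def])
  have Acont: "(A \<longlongrightarrow> ?R) (at 0)"
    using has_vector_derivative_continuous[OF A'] by (simp add: isCont_def A0)
  \<comment> \<open>Twice differentiability enters here, through continuity of the first derivative
    of \<rho>.\<close>
  have Yt: "((\<lambda>t. ?Y (t *\<^sub>R axis i 1)) \<longlongrightarrow> mat_schur (powr_dd s) ?R (d\<rho> j \<theta>)) (at 0)"
  proof (rule mat_schur_tendsto[OF pos continuous_on_powr_dd pos])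
    show "((\<lambda>t. \<rho> (\<theta> + t *\<^sub>R axis i 1)) \<longlongrightarrow> ?R) (at 0)"
      using Acont by (simp add: A_def[abs_def])
    have "((\<lambda>t. \<theta> + t *\<^sub>R axis i 1) \<longlongrightarrow> \<theta> + 0 *\<^sub>R axis i 1) (at 0)"
      by (intro tendsto_intros)
    then show "((\<lambda>t. d\<rho> j (\<theta> + t *\<^sub>R axis i 1)) \<longlongrightarrow> d\<rho> j \<theta>) (at 0)"
      unfolding d\<rho>_def using cont'
      by (intro tendsto_intros isCont_tendsto_compose[of _ \<rho>']) auto
  qed
  \<comment> \<open>At A = R the sandwich is R^(1/\<alpha>), whose power \<alpha> is
    \<open>R\<close> with trace 1.\<close>
  have q0: "?q ?R = 1"
    using assms(2)[of \<theta>] \<alpha>(1) mat_powr_mat_powr[OF pos[of \<theta>], of "1 / \<alpha>" \<alpha>]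
    by (simp add: sandwich_self[OF pos \<alpha>(1) s_def] mat_powr_1[OF pos] quantum_state_def)
  have qt: "((\<lambda>t. ?q (A t)) \<longlongrightarrow> 1) (at 0)"
    using has_vector_derivative_continuous[OF sandwich_trace_has_vector_derivative[OF pos[of \<theta>] Apos A' tr,
          where s = s and \<alpha> = \<alpha>]]
    unfolding isCont_def A0 by (auto dest: tendsto_Re simp: q0)
  \<comment> \<open>The first partial derivative along the line in direction i. As its factor
    \<open>?Z\<close> vanishes at t = 0, the difference quotient of \<open>G\<close> is that of
    \<open>?Z\<close> times quantities that merely converge; no derivative of \<open>?Y\<close> or
    of the denominator appears.\<close>
  define G where "G t = \<alpha> / (\<alpha> - 1) * Re (trace (?Z (A t) ** ?Y (t *\<^sub>R axis i 1))) / ?q (A t)" for t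
  let ?D = "\<alpha> / (\<alpha> - 1) * Re (trace (?W ** mat_schur (powr_dd s) ?R (d\<rho> j \<theta>))) / 1"
  have "(G has_vector_derivative ?D) (at 0)"
  proof -
    have "(G t - G 0) /\<^sub>R (t - 0) = \<alpha> / (\<alpha> - 1) *
        Re (trace (((?Z (A t) - ?Z (A 0)) /\<^sub>R (t - 0)) ** ?Y (t *\<^sub>R axis i 1))) / ?q (A t)" for t
      by (simp add: G_def Z0 matrix_scaleR_left trace_scaleR trace_zero)
    moreover have "((\<lambda>t. \<alpha> / (\<alpha> - 1) *
        Re (trace (((?Z (A t) - ?Z (A 0)) /\<^sub>R (t - 0)) ** ?Y (t *\<^sub>R axis i 1))) / ?q (A t)) \<longlongrightarrow> ?D) (at 0)"
      by (intro tendsto_intros tendsto_Re bounded_linear.tendsto[OF bounded_linear_trace]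
          mmult.tendsto Yt qt Z'[unfolded has_vector_derivative_iff_tendsto]) simp
    ultimately show ?thesis
      unfolding has_vector_derivative_iff_tendsto by simp
  qed
  then have "vector_derivative G (at 0) = ?D"
    by (rule vector_derivative_at)
  moreover have "G = (\<lambda>t. partial j (\<lambda>\<epsilon>. sandwiched_renyi \<alpha> ?R (\<rho> (\<theta> + \<epsilon>))) (0 + t *\<^sub>R axis i 1))"
    by (rule ext) (simp only: grad G_def A_def add_0)
  ultimately have "sandwiched_renyi_info \<alpha> \<rho> \<theta> $ i $ j = 1 / \<alpha> * ?D"
    by (simp only: sandwiched_renyi_info_def vec_lambda_beta partial_def[of i])
  also have "\<dots> = 1 / (\<alpha> - 1) * Re (trace (?W ** mat_schur (powr_dd s) ?R (d\<rho> j \<theta>)))"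
    using \<alpha> by simp
  also have "\<dots> = (\<Sum>k\<in>K. \<Sum>l\<in>K. sandwiched_zeta \<alpha> (lam k) (lam l) *
      Re (trace (P k ** d\<rho> i \<theta> ** P l ** d\<rho> j \<theta>)))"
    unfolding trace_mat_schur_mult_mat_schur[OF sd] Re_sum sum_distrib_left
    using sandwich_symbol_eq_zeta[OF \<alpha> s_def] positive_definite_eigenvalue_pos[OF pos sd]
    by (intro sum.cong refl) (simp flip: mult.assoc)
  finally have info: "sandwiched_renyi_info \<alpha> \<rho> \<theta> $ i $ j = Re (\<Sum>k\<in>K. \<Sum>l\<in>K.
      complex_of_real (sandwiched_zeta \<alpha> (lam k) (lam l)) * trace (P k ** d\<rho> i \<theta> ** P l ** d\<rho> j \<theta>))"
    by simp
  \<comment> \<open>So far only the real part of the double sum is identified. The sum is real: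
    conjugation reverses the products under the trace, which exchanges k and l, and the coefficient
    is symmetric.\<close>
  let ?rhs = "\<Sum>k\<in>K. \<Sum>l\<in>K.
      complex_of_real (sandwiched_zeta \<alpha> (lam k) (lam l)) * trace (P k ** d\<rho> i \<theta> ** P l ** d\<rho> j \<theta>)"
  have zeta_commute: "sandwiched_zeta \<alpha> x y = sandwiched_zeta \<alpha> y x" for x y
    by (simp add: sandwiched_zeta_def divide_simps) (simp add: algebra_simps)
  have conj: "cnj (trace (P k ** d\<rho> i \<theta> ** P l ** d\<rho> j \<theta>)) = trace (P l ** d\<rho> i \<theta> ** P k ** d\<rho> j \<theta>)"
    if "k \<in> K" "l \<in> K" for k l
  proof -
    have "cnj (trace (P k ** d\<rho> i \<theta> ** P l ** d\<rho> j \<theta>)) = trace (d\<rho> j \<theta> ** (P l ** d\<rho> i \<theta> ** P k))"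
      using that by (simp add: cadjoint_mult herm spectral_decomposition_cadjoint[OF sd]
          matrix_mul_assoc flip: trace_cadjoint)
    then show ?thesis
      by (simp only: trace_mult_commute[of "d\<rho> j \<theta>"])
  qed
  have "cnj ?rhs = (\<Sum>k\<in>K. \<Sum>l\<in>K.
      complex_of_real (sandwiched_zeta \<alpha> (lam l) (lam k)) * trace (P l ** d\<rho> i \<theta> ** P k ** d\<rho> j \<theta>))"
    unfolding cnj_sum complex_cnj_mult complex_cnj_complex_of_real
    by (intro sum.cong refl) (simp only: conj zeta_commute)
  also have "\<dots> = ?rhs" by (rule sum.swap)
  finally have "?rhs \<in> \<real>" by (simp add: Reals_cnj_iff)
  then show ?thesis
    unfolding info partial by (rule of_real_Re)
qed

end
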